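(* Let $A\in[0,1]^{n\times n}$ and $x\in[0,1]^n$. There exists an integer $T$ such that for all $t\ge T$: (1) if $\rho(A)<1$ then $A^{\otimes_L t}\otimes_L x=\mathbf{0}$; (2) if $\rho(A)=1$ then $A^{\otimes_L t}\otimes_L x=C\otimes S^t\otimes R\otimes x\oplus\mathbf{0}$, and moreover $(A^{\otimes_L t}\otimes_L x)_i=\big(S^t\otimes R\otimes(x\oplus\mathbf{0})\big)_i$ for all $i=1,\dots,c$.
   Context: $a\otimes_L b=\max(0,a+b-1)$, $(A\otimes_L B)_{ik}=\max_j\max(0,a_{ij}+b_{jk}-1)$, $A^{\otimes_L t}$ is the $t$-th max-Łukasiewicz power. Tropical arithmetic on $\mathbb{R}\cup\{-\infty\}$: $a\oplus b=\max(a,b)$, $(B\otimes C)_{ik}=\max_j(b_{ij}+c_{jk})$, $S^t$ the $t$-th tropical power; $\mathbf{0}$ is the zero vector. $\rho(A)$ is the maximum cycle mean of $A$. $A^{(1)}$ has entries $a_{ij}-1$. When $\rho(A)=1$: the critical graph of $A$ consists of the nodes and edges of the digraph of $A$ lying on cycles of mean $1$ (i.e., cycles all of whose edges have weight $1$); its nodes are assumed (after relabeling) to be $1,\dots,c$; $\gamma$ is its cyclicity (the lcm over its strongly connected components of the gcd of the lengths of the simple cycles in the component); $C$ ($n\times c$) and $R$ ($c\times n$) consist of columns, respectively rows, $1,\dots,c$ of the tropical Kleene star $((A^{(1)})^{\gamma})^*=I\oplus (A^{(1)})^\gamma\oplus((A^{(1)})^\gamma)^2\oplus\cdots$; and $S$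 is the $c\times c$ matrix with $s_{ij}=a_{ij}-1$ if $(i,j)$ is an edge of the critical graph and $s_{ij}=-\infty$ otherwise. *)

theory Defs
  imports
    "HOL-Library.Extended_Real"
    "Jordan_Normal_Form.Matrix"
    "Graph_Theory.Graph_Theory"
begin

text \<open>
  Matrices and vectors are those of \<^theory>\<open>Jordan_Normal_Form.Matrix\<close>, so that indices
  start at \<open>0\<close>: the index set \<open>{1, ..., n}\<close> of the usual notation is \<open>{0..<n}\<close> here.
\<close>

section \<open>Max-Lukasiewicz matrix algebra\<close>

definition luk_times :: "real \<Rightarrow> real \<Rightarrow> real" (infixl \<open>\<otimes>\<^sub>L\<close> 70) where
  "a \<otimes>\<^sub>L b = max 0 (a + b - 1)"

definition luk_mult :: "real mat \<Rightarrow> real mat \<Rightarrow> real mat" where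
  "luk_mult A B = mat (dim_row A) (dim_col B)
     (\<lambda>(i, k). MAX j\<in>{0..<dim_col A}. (A $$ (i, j)) \<otimes>\<^sub>L (B $$ (j, k)))"

definition luk_mult_vec :: "real mat \<Rightarrow> real vec \<Rightarrow> real vec" where
  "luk_mult_vec A x = vec (dim_row A) (\<lambda>i. MAX j\<in>{0..<dim_col A}. (A $$ (i, j)) \<otimes>\<^sub>L (x $ j))"

text \<open>The ordinary identity matrix is also neutral for \<^const>\<open>luk_mult\<close> on matrices over \<open>[0,1]\<close>.\<close>

primrec luk_pow :: "real mat \<Rightarrow> nat \<Rightarrow> real mat" where
  "luk_pow A 0 = 1\<^sub>m (dim_row A)"
| "luk_pow A (Suc t) = luk_mult (luk_pow A t) A"

section \<open>Tropical matrix algebra\<close>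

text \<open>
  The tropical semiring \<open>\<real> \<union> {-\<infinity>}\<close> is embedded into \<^typ>\<open>ereal\<close>. Suprema over finite
  nonempty index sets are maxima, and \<^typ>\<open>ereal\<close> makes the supremum over the empty set the
  tropical zero \<open>-\<infinity>\<close>. The value \<open>+\<infinity>\<close> could only enter through a divergent Kleene star.
\<close>

definition trop_mult :: "ereal mat \<Rightarrow> ereal mat \<Rightarrow> ereal mat" (infixl \<open>\<otimes>\<^sub>T\<close> 70) where
  "B \<otimes>\<^sub>T C = mat (dim_row B) (dim_col C)
     (\<lambda>(i, k). SUP j\<in>{0..<dim_col B}. B $$ (i, j) + C $$ (j, k))"

definition trop_mult_vec :: "ereal mat \<Rightarrow> ereal vec \<Rightarrow> ereal vec" (infixl \<open>\<otimes>\<^sub>T\<^sub>v\<close> 70) where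
  "B \<otimes>\<^sub>T\<^sub>v x = vec (dim_row B) (\<lambda>i. SUP j\<in>{0..<dim_col B}. B $$ (i, j) + x $ j)"

definition trop_add_vec :: "ereal vec \<Rightarrow> ereal vec \<Rightarrow> ereal vec" (infixl \<open>\<oplus>\<^sub>T\<^sub>v\<close> 65) where
  "x \<oplus>\<^sub>T\<^sub>v y = vec (dim_vec x) (\<lambda>i. max (x $ i) (y $ i))"

definition trop_one :: "nat \<Rightarrow> ereal mat" where
  "trop_one n = mat n n (\<lambda>(i, j). if i = j then 0 else -\<infinity>)"

primrec trop_pow :: "ereal mat \<Rightarrow> nat \<Rightarrow> ereal mat" where
  "trop_pow B 0 = trop_one (dim_row B)"
| "trop_pow B (Suc t) = trop_pow B t \<otimes>\<^sub>T B"

definition kleene_star :: "ereal mat \<Rightarrow> ereal mat" where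
  "kleene_star B = mat (dim_row B) (dim_row B) (\<lambda>ij. SUP k. trop_pow B k $$ ij)"

section \<open>Cycle means and the critical graph\<close>

text \<open>A real matrix has no entry \<open>-\<infinity>\<close>, so its digraph is complete, with all loops.\<close>

definition mat_digraph :: "real mat \<Rightarrow> nat pair_pre_digraph" where
  "mat_digraph A = \<lparr>pverts = {0..<dim_row A}, parcs = {0..<dim_row A} \<times> {0..<dim_row A}\<rparr>"

text \<open>
  A cycle is a nonempty closed walk, given by its list of edges; simple cycles are those
  satisfying \<^const>\<open>pre_digraph.cycle\<close>.
\<close>

definition mat_cycles :: "real mat \<Rightarrow> (nat \<times> nat) list set" where
  "mat_cycles A = {p. p \<noteq> [] \<and> (\<exists>u. pre_digraph.awalk (mat_digraph A) u p u)}"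

definition cycle_mean :: "real mat \<Rightarrow> (nat \<times> nat) list \<Rightarrow> real" where
  "cycle_mean A p = (\<Sum>e\<leftarrow>p. A $$ e) / real (length p)"

text \<open>
  The supremum is a maximum when the dimension is positive, see \<open>max_cycle_mean_attained\<close>
  and \<open>cycle_mean_le_max_cycle_mean\<close> below.
\<close>

definition max_cycle_mean :: "real mat \<Rightarrow> real" where
  "max_cycle_mean A = (SUP p\<in>mat_cycles A. cycle_mean A p)"

definition critical_cycles :: "real mat \<Rightarrow> (nat \<times> nat) list set" where
  "critical_cycles A = {p \<in> mat_cycles A. cycle_mean A p = max_cycle_mean A}"

text \<open>Every node of a cycle is the tail of one of its edges.\<close>

definition critical_graph :: "real mat \<Rightarrow> nat pair_pre_digraph" where
  "critical_graph A =
     \<lparr>pverts = (\<Union>p\<in>critical_cycles A. fst ` set p), parcs = (\<Union>p\<in>critical_cycles A. set p)\<rparr>"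

definition cyclicity :: "('a, 'b) pre_digraph \<Rightarrow> nat" where
  "cyclicity G = (LCM H\<in>pre_digraph.sccs G. GCD p\<in>{p. pre_digraph.cycle H p}. length p)"

section \<open>The CSR terms\<close>

definition mat_minus_one :: "real mat \<Rightarrow> ereal mat" where
  "mat_minus_one A = map_mat (\<lambda>a. ereal (a - 1)) A"

definition csr_star :: "real mat \<Rightarrow> ereal mat" where
  "csr_star A = kleene_star (trop_pow (mat_minus_one A) (cyclicity (critical_graph A)))"

text \<open>The parameter \<open>c\<close> is the number of critical nodes, which are assumed to be \<open>{0..<c}\<close>.\<close>

definition csr_C :: "real mat \<Rightarrow> nat \<Rightarrow> ereal mat" where
  "csr_C A c = mat (dim_row A) c (\<lambda>ij. csr_star A $$ ij)"

definition csr_R :: "real mat \<Rightarrow> nat \<Rightarrow> ereal mat" where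
  "csr_R A c = mat c (dim_row A) (\<lambda>ij. csr_star A $$ ij)"

definition csr_S :: "real mat \<Rightarrow> nat \<Rightarrow> ereal mat" where
  "csr_S A c = mat c c
     (\<lambda>ij. if ij \<in> parcs (critical_graph A) then ereal (A $$ ij - 1) else -\<infinity>)"

section \<open>The maximum cycle mean is attained\<close>

lemma max_cycle_mean_aux:
  assumes n: "dim_row A > 0"
  obtains p where "p \<in> mat_cycles A" "pre_digraph.cycle (mat_digraph A) p"
    "\<And>q. q \<in> mat_cycles A \<Longrightarrow> cycle_mean A q \<le> cycle_mean A p"
proof -
  let ?G = "with_proj (mat_digraph A)"
  interpret fin_digraph ?G
    by unfold_locales (auto simp: mat_digraph_def)
  define Z where "Z = {p. cycle p}"
  have "Z \<subseteq> {p. set p \<subseteq> arcs ?G \<and> length p \<le> card (arcs ?G)}"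
  proof
    fix p assume "p \<in> Z"
    then obtain u where "awalk u p u" "distinct p" by (auto simp: Z_def cycle_conv)
    moreover from this have "set p \<subseteq> arcs ?G" by blast
    ultimately have "set p \<subseteq> arcs ?G" "length p \<le> card (arcs ?G)"
      using card_mono[OF finite_arcs, of "set p"] by (auto simp: distinct_card)
    then show "p \<in> {p. set p \<subseteq> arcs ?G \<and> length p \<le> card (arcs ?G)}" by auto
  qed
  then have finZ: "finite Z"
    by (rule finite_subset) (intro finite_lists_length_le finite_arcs)
  have "(0, 0) \<in> arcs ?G" using n by (auto simp: mat_digraph_def)
  then have "awalk 0 [(0, 0)] 0" using arc_implies_awalk by fastforce
  then have "cycle [(0, 0)]" unfolding cycle_def by (intro exI[of _ 0]) auto
  then have neZ: "Z \<noteq> {}" by (auto simp: Z_def)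
  define M where "M = Max (cycle_mean A ` Z)"
  obtain p where p: "p \<in> Z" "cycle_mean A p = M"
    using Max_in[of "cycle_mean A ` Z"] finZ neZ unfolding M_def by fastforce
  have bound: "(\<Sum>e\<leftarrow>q. A $$ e) \<le> M * real (length q)" if "awalk u q u" for u q
    using that
  proof (induction "length q" arbitrary: u q rule: less_induct)
    case less
    consider "q = []" | "cycle q"
      | e es where "q = e # es" "\<not> distinct (tl (awalk_verts u q))"
      using less.prems by (cases q) (auto simp: cycle_def)
    then show ?case
    proof cases
      case 2
      then have "cycle_mean A q \<le> M" "q \<noteq> []"
        using finZ unfolding M_def by (auto simp: Z_def cycle_def intro!: Max_ge)
      then show ?thesis by (simp add: cycle_mean_def divide_simps)
    next
      case 3
      then have es: "awalk (snd e) es u" "\<not> distinct (awalk_verts (snd e) es)"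
        using less.prems by (auto simp: awalk_Cons_iff)
      obtain r s t w where rst: "es = r @ s @ t" "0 < length s"
        "awalk (snd e) r w" "awalk w s w" "awalk w t u"
        using awalk_not_distinct_decomp[OF es] by blast
      have "awalk u (e # r @ t) u"
        using less.prems rst 3 by (auto simp: awalk_Cons_iff)
      with less.hyps[of "e # r @ t" u] less.hyps[of s w] rst 3
      have "(\<Sum>e\<leftarrow>e # r @ t. A $$ e) \<le> M * real (length (e # r @ t))"
        "(\<Sum>e\<leftarrow>s. A $$ e) \<le> M * real (length s)" by auto
      with rst 3 show ?thesis by (simp add: algebra_simps)
    qed auto
  qed
  show ?thesis
  proof (rule that)
    show "p \<in> mat_cycles A" "cycle p" using p by (auto simp: Z_def mat_cycles_def cycle_def)
    fix q assume "q \<in> mat_cycles A"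
    then show "cycle_mean A q \<le> cycle_mean A p"
      using bound[of _ q] p by (auto simp: mat_cycles_def cycle_mean_def divide_simps)
  qed
qed

lemma max_cycle_mean_attained:
  assumes "dim_row A > 0"
  shows "\<exists>p\<in>mat_cycles A. pre_digraph.cycle (mat_digraph A) p \<and> cycle_mean A p = max_cycle_mean A"
  using assms
  by (rule max_cycle_mean_aux)
    (auto simp: max_cycle_mean_def intro!: cSup_eq_maximum[symmetric] bexI)

lemma cycle_mean_le_max_cycle_mean:
  assumes "p \<in> mat_cycles A"
  shows "cycle_mean A p \<le> max_cycle_mean A"
proof -
  have n: "dim_row A > 0"
    using assms by (auto simp: mat_cycles_def mat_digraph_def pre_digraph.awalk_def)
  obtain q where "q \<in> mat_cycles A" "\<And>r. r \<in> mat_cycles A \<Longrightarrow> cycle_mean A r \<le> cycle_mean A q"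
    using n by (rule max_cycle_mean_aux) blast
  then show ?thesis
    unfolding max_cycle_mean_def using assms by (intro cSUP_upper bdd_aboveI2) auto
qed

end

theory Submission
  imports Defs "HOL-Computational_Algebra.Group_Closure"
begin

text \<open>
  The matrix \<open>B\<close> with entries \<open>a\<^sub>i\<^sub>j - 1 \<le> 0\<close> turns the max-Lukasiewicz product into the tropical one:
  every value of \<open>A\<^sup>t x\<close> is the tropical value of \<open>B\<^sup>t x\<close>, cut off at \<open>0\<close>. A walk that avoids the
  critical nodes meets an edge of negative weight in every \<open>n\<close> consecutive steps, since otherwise
  it would close up a cycle of weight \<open>0\<close>; so for large \<open>t\<close> its weight is at most \<open>-1\<close> and the
  cut-off hides it. A walk through a critical node \<open>k\<close> can be extended on both sides of \<open>k\<close> by critical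
  edges, which cost nothing, until both parts have a length divisible by \<open>\<gamma>\<close>; this turns the walk into a
  term of \<open>C S\<^sup>t R\<close>. Conversely, since \<open>B \<le> 0\<close>, deleting cycles shows that the Kleene star is attained by
  boundedly long walks, and critical walks of every sufficiently large length in the right residue class
  modulo \<open>\<gamma>\<close> exist; so every term of \<open>C S\<^sup>t R\<close> is the weight of a walk of length exactly \<open>t\<close>.
\<close>

section \<open>Tropical powers and walks\<close>

lemma SUP_finite_attained:
  fixes f :: "'a \<Rightarrow> 'b :: complete_linorder"
  assumes "finite I" "I \<noteq> {}"
  obtains i where "i \<in> I" "(SUP i\<in>I. f i) = f i"
  using assms Max_in[of "f ` I"] by (auto simp: Max_Sup)

lemma ereal_Max:
  assumes "finite I" "I \<noteq> {}"
  shows "ereal (MAX i\<in>I. f i) = (SUP i\<in>I. ereal (f i))"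
  using assms mono_Max_commute[of ereal "f ` I"] by (simp add: Max_Sup image_image mono_def)

lemma mono_SUP_finite:
  fixes f :: "'a \<Rightarrow> 'b :: complete_linorder" and g :: "'b \<Rightarrow> 'c :: complete_linorder"
  assumes "mono g" "finite I" "I \<noteq> {}"
  shows "g (SUP i\<in>I. f i) = (SUP i\<in>I. g (f i))"
  using assms mono_Max_commute[of g "f ` I"] by (simp add: Max_Sup image_image)

lemma trop_pow_carrier [simp]: "B \<in> carrier_mat n n \<Longrightarrow> trop_pow B t \<in> carrier_mat n n"
  by (induction t) (auto simp: trop_one_def trop_mult_def)

lemma index_trop_pow_0:
  "B \<in> carrier_mat n n \<Longrightarrow> i < n \<Longrightarrow> j < n \<Longrightarrow> trop_pow B 0 $$ (i, j) = (if i = j then 0 else -\<infinity>)"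
  by (auto simp: trop_one_def)

lemma index_trop_pow_Suc:
  assumes "B \<in> carrier_mat n n" "i < n" "j < n"
  shows "trop_pow B (Suc t) $$ (i, j) = (SUP l\<in>{0..<n}. trop_pow B t $$ (i, l) + B $$ (l, j))"
  using assms carrier_matD[OF trop_pow_carrier[OF assms(1), of t]] by (simp add: trop_mult_def)

text \<open>A walk is a function on time points of which only the values up to \<open>t\<close>
  matter, so a later section of a walk is just the shift
  \<open>\<lambda>m. w (s + m)\<close>.\<close>

definition walk_weight :: "ereal mat \<Rightarrow> (nat \<Rightarrow> nat) \<Rightarrow> nat \<Rightarrow> ereal" where
  "walk_weight B w t = (\<Sum>m<t. B $$ (w m, w (Suc m)))"

lemma walk_weight_simps [simp]:
  "walk_weight B w 0 = 0"
  "walk_weight B w (Suc t) = walk_weight B w t + B $$ (w t, w (Suc t))"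
  by (simp_all add: walk_weight_def)

lemma walk_weight_add:
  "walk_weight B w (s + t) = walk_weight B w s + walk_weight B (\<lambda>m. w (s + m)) t"
  by (induction t) (simp_all add: add.assoc)

lemma walk_weight_cong:
  "(\<And>m. m \<le> t \<Longrightarrow> w m = w' m) \<Longrightarrow> walk_weight B w t = walk_weight B w' t"
  by (induction t) simp_all

lemma walk_in_trancl:
  assumes "0 < d" "\<And>m. m < d \<Longrightarrow> (w m, w (Suc m)) \<in> Z"
  shows "(w 0, w d) \<in> Z\<^sup>+"
  using assms
proof (induction d)
  case (Suc d)
  then show ?case
    by (cases "d = 0") (auto intro: trancl_into_trancl)
qed simp

text \<open>With nonpositive weights, dropping a closed part never makes a walk worse. They also
  exclude \<open>\<infinity>\<close>, so that \<open>-\<infinity>\<close> stays absorbing: in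
  \<open>ereal\<close> the sum of \<open>\<infinity>\<close> and \<open>-\<infinity>\<close> is
  \<open>\<infinity>\<close>.\<close>

locale nonpos_mat =
  fixes n :: nat and B :: "ereal mat"
  assumes carrier [simp]: "B \<in> carrier_mat n n"
    and nonpos: "\<And>i j. i < n \<Longrightarrow> j < n \<Longrightarrow> B $$ (i, j) \<le> 0"
begin

section \<open>Powers of a matrix with nonpositive entries\<close>

lemma pow_0: "i < n \<Longrightarrow> j < n \<Longrightarrow> trop_pow B 0 $$ (i, j) = (if i = j then 0 else -\<infinity>)"
  using index_trop_pow_0[OF carrier] .

lemma pow_Suc_ge:
  assumes "i < n" "j < n" "l < n"
  shows "trop_pow B t $$ (i, l) + B $$ (l, j) \<le> trop_pow B (Suc t) $$ (i, j)"
  using assms by (auto simp: index_trop_pow_Suc[OF carrier] simp del: trop_pow.simps intro!: SUP_upper2[of l])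

lemma pow_Suc_attained:
  assumes "i < n" "j < n"
  obtains l where "l < n" "trop_pow B (Suc t) $$ (i, j) = trop_pow B t $$ (i, l) + B $$ (l, j)"
proof -
  obtain l where "l \<in> {0..<n}"
    "(SUP l\<in>{0..<n}. trop_pow B t $$ (i, l) + B $$ (l, j)) = trop_pow B t $$ (i, l) + B $$ (l, j)"
    by (rule SUP_finite_attained[of "{0..<n}" "\<lambda>l. trop_pow B t $$ (i, l) + B $$ (l, j)"]) (use assms in auto)
  then show ?thesis
    using that[of l] assms by (simp add: index_trop_pow_Suc[OF carrier] del: trop_pow.simps)
qed

lemma pow_nonpos: "i < n \<Longrightarrow> j < n \<Longrightarrow> trop_pow B t $$ (i, j) \<le> 0"
proof (induction t arbitrary: j)
  case 0
  then show ?case by (simp add: pow_0 del: trop_pow.simps)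
next
  case (Suc t)
  then obtain l where "l < n" "trop_pow B (Suc t) $$ (i, j) = trop_pow B t $$ (i, l) + B $$ (l, j)"
    using pow_Suc_attained by metis
  with Suc show ?case using nonpos[of l j] by (simp add: add_nonpos_nonpos)
qed

lemma pow_supermult:
  assumes "i < n" "k < n" "j < n"
  shows "trop_pow B s $$ (i, k) + trop_pow B t $$ (k, j) \<le> trop_pow B (s + t) $$ (i, j)"
  using assms(3)
proof (induction t arbitrary: j)
  case 0
  then show ?case
    using assms pow_nonpos[of i k s] by (cases "trop_pow B s $$ (i, k)") (auto simp: pow_0 simp del: trop_pow.simps)
next
  case (Suc t)
  then obtain l where l: "l < n" "trop_pow B (Suc t) $$ (k, j) = trop_pow B t $$ (k, l) + B $$ (l, j)"
    using pow_Suc_attained[OF assms(2)] by metis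
  have "trop_pow B s $$ (i, k) + trop_pow B (Suc t) $$ (k, j)
      = trop_pow B s $$ (i, k) + trop_pow B t $$ (k, l) + B $$ (l, j)"
    using l by (simp add: add.assoc del: trop_pow.simps)
  also have "\<dots> \<le> trop_pow B (s + t) $$ (i, l) + B $$ (l, j)"
    by (intro add_right_mono Suc.IH l)
  also have "\<dots> \<le> trop_pow B (s + Suc t) $$ (i, j)"
    using pow_Suc_ge[of i j l "s + t"] assms Suc.prems l by (simp del: trop_pow.simps)
  finally show ?case .
qed

text \<open>An optimal walk is cut after its first \<open>s\<close> steps; this is the converse of
  \<open>pow_supermult\<close>.\<close>

lemma pow_add_attained:
  assumes "i < n" "j < n"
  shows "\<exists>k<n. trop_pow B (s + t) $$ (i, j) \<le> trop_pow B s $$ (i, k) + trop_pow B t $$ (k, j)"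
  using assms(2)
proof (induction t arbitrary: j)
  case 0
  then show ?case by (auto simp: pow_0 simp del: trop_pow.simps intro!: exI[of _ j])
next
  case (Suc t)
  then obtain l where l: "l < n" "trop_pow B (Suc (s + t)) $$ (i, j) = trop_pow B (s + t) $$ (i, l) + B $$ (l, j)"
    using pow_Suc_attained[OF assms(1)] by metis
  obtain k where k: "k < n" "trop_pow B (s + t) $$ (i, l) \<le> trop_pow B s $$ (i, k) + trop_pow B t $$ (k, l)"
    using Suc.IH[OF l(1)] by auto
  have "trop_pow B (s + Suc t) $$ (i, j) \<le> trop_pow B s $$ (i, k) + trop_pow B t $$ (k, l) + B $$ (l, j)"
    using l(2) k(2) by (simp add: add_right_mono del: trop_pow.simps)
  also have "\<dots> \<le> trop_pow B s $$ (i, k) + trop_pow B (Suc t) $$ (k, j)"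
    using pow_Suc_ge[OF k(1) Suc.prems l(1)] by (simp add: add.assoc add_left_mono del: trop_pow.simps)
  finally show ?case using k(1) by blast
qed

lemma nonpos_mat_pow: "nonpos_mat n (trop_pow B g)"
  by unfold_locales (auto intro: pow_nonpos)

text \<open>The Kleene star in \<open>csr_star\<close> is taken of \<open>trop_pow B g\<close>;
  through this identity its terms become best weights of walks of length
  \<open>g * m\<close>.\<close>

lemma pow_pow: "i < n \<Longrightarrow> j < n \<Longrightarrow> trop_pow (trop_pow B g) m $$ (i, j) = trop_pow B (g * m) $$ (i, j)"
proof (induction m arbitrary: j)
  case 0
  then show ?case using pow_0 nonpos_mat.pow_0[OF nonpos_mat_pow] by simp
next
  case (Suc m)
  interpret P: nonpos_mat n "trop_pow B g" by (rule nonpos_mat_pow)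
  obtain l where l: "l < n"
    "trop_pow (trop_pow B g) (Suc m) $$ (i, j) = trop_pow (trop_pow B g) m $$ (i, l) + trop_pow B g $$ (l, j)"
    using P.pow_Suc_attained Suc.prems by metis
  obtain k where k: "k < n"
    "trop_pow B (g * m + g) $$ (i, j) \<le> trop_pow B (g * m) $$ (i, k) + trop_pow B g $$ (k, j)"
    using pow_add_attained[OF Suc.prems] by blast
  show ?case
  proof (rule antisym)
    show "trop_pow (trop_pow B g) (Suc m) $$ (i, j) \<le> trop_pow B (g * Suc m) $$ (i, j)"
      using l Suc pow_supermult[of i l j "g * m" g] by (simp add: add.commute del: trop_pow.simps)
    show "trop_pow B (g * Suc m) $$ (i, j) \<le> trop_pow (trop_pow B g) (Suc m) $$ (i, j)"
      using k Suc P.pow_Suc_ge[of i j k m] by (simp add: add.commute del: trop_pow.simps)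
  qed
qed

section \<open>Powers as optimal walk weights\<close>

lemma walk_weight_le_pow:
  "(\<And>m. m \<le> t \<Longrightarrow> w m < n) \<Longrightarrow> walk_weight B w t \<le> trop_pow B t $$ (w 0, w t)"
proof (induction t)
  case 0
  then show ?case by (simp add: pow_0 del: trop_pow.simps)
next
  case (Suc t)
  then show ?case
    using pow_Suc_ge[of "w 0" "w (Suc t)" "w t" t]
    by (auto simp del: trop_pow.simps intro: order_trans[OF add_right_mono])
qed

text \<open>An entry \<open>-\<infinity>\<close> is excluded because for \<open>t = 0\<close> and
  \<open>i \<noteq> j\<close> there is no walk at all.\<close>

lemma pow_walk:
  assumes "i < n" "j < n" "trop_pow B t $$ (i, j) \<noteq> -\<infinity>"
  shows "\<exists>w. w 0 = i \<and> w t = j \<and> (\<forall>m\<le>t. w m < n) \<and> walk_weight B w t = trop_pow B t $$ (i, j)"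
  using assms(2,3)
proof (induction t arbitrary: j)
  case 0
  then show ?case using assms(1) by (auto simp: pow_0 simp del: trop_pow.simps split: if_splits)
next
  case (Suc t)
  obtain l where l: "l < n" "trop_pow B (Suc t) $$ (i, j) = trop_pow B t $$ (i, l) + B $$ (l, j)"
    using pow_Suc_attained assms(1) Suc.prems(1) by metis
  with Suc.prems nonpos[of l j] have "trop_pow B t $$ (i, l) \<noteq> -\<infinity>"
    by (auto simp del: trop_pow.simps)
  with Suc.IH l obtain w where w: "w 0 = i" "w t = l" "\<forall>m\<le>t. w m < n"
    "walk_weight B w t = trop_pow B t $$ (i, l)" by blast
  define w' where "w' = w(Suc t := j)"
  have w': "w' m = w m" if "m \<le> t" for m using that by (simp add: w'_def)
  have "w' (Suc t) = j" by (simp add: w'_def)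
  moreover have "walk_weight B w' t = walk_weight B w t"
    by (rule walk_weight_cong) (rule w')
  ultimately show ?case
    using w l Suc.prems w' by (intro exI[of _ w']) (simp add: le_Suc_eq all_conj_distrib del: trop_pow.simps)
qed

section \<open>Shortening of walks, the Kleene star and decay\<close>

lemma walk_weight_nonpos: "(\<And>m. m \<le> t \<Longrightarrow> w m < n) \<Longrightarrow> walk_weight B w t \<le> 0"
  by (metis le0 order.refl order_trans pow_nonpos walk_weight_le_pow)

lemma walk_weight_le_split:
  assumes "\<And>m. m \<le> s + t \<Longrightarrow> w m < n"
  shows "walk_weight B w (s + t) \<le> trop_pow B s $$ (w 0, w s) + trop_pow B t $$ (w s, w (s + t))"
  using walk_weight_le_pow[of s w] walk_weight_le_pow[of t "\<lambda>m. w (s + m)"] assms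
  by (simp add: walk_weight_add add_mono)

text \<open>By pigeonhole, a node recurs among the first \<open>n + 1\<close> positions of an
  optimal walk, so a closed part can be removed.\<close>

lemma pow_le_shorter:
  assumes "i < n" "j < n" "n \<le> m"
  shows "\<exists>m'<m. trop_pow B m $$ (i, j) \<le> trop_pow B m' $$ (i, j)"
proof (cases "trop_pow B m $$ (i, j) = -\<infinity>")
  case True
  then show ?thesis using assms by (intro exI[of _ 0]) auto
next
  case False
  then obtain w where w: "w 0 = i" "w m = j" "\<forall>l\<le>m. w l < n"
    "walk_weight B w m = trop_pow B m $$ (i, j)"
    using pow_walk assms by blast
  have "\<not> inj_on w {..n}"
    using card_inj_on_le[of w "{..n}" "{..<n}"] w(3) assms(3) by fastforce
  then obtain p q where pq: "p < q" "q \<le> n" "w p = w q"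
    unfolding inj_on_def by (metis atMost_iff linorder_neqE_nat)
  obtain d r where dr: "q = p + d" "m = q + r" "0 < d"
    using pq assms(3) by (metis le_trans less_imp_add_positive nat_le_iff_add)
  (* As weights are nonpositive, cutting out the closed part between p and q does not decrease the weight. *)
  have "walk_weight B w m = walk_weight B w p + walk_weight B (\<lambda>l. w (p + l)) d + walk_weight B (\<lambda>l. w (q + l)) r"
    by (simp add: dr walk_weight_add add.assoc)
  also have "\<dots> \<le> trop_pow B p $$ (i, w p) + 0 + trop_pow B r $$ (w q, j)"
    using walk_weight_le_pow[of p w] walk_weight_nonpos[of d "\<lambda>l. w (p + l)"]
      walk_weight_le_pow[of r "\<lambda>l. w (q + l)"] w dr
    by (intro add_mono) auto
  also have "\<dots> \<le> trop_pow B (p + r) $$ (i, j)"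
    using pow_supermult[of i "w p" j p r] pq w dr assms by simp
  finally show ?thesis using w dr by (intro exI[of _ "p + r"]) auto
qed

lemma pow_le_short:
  assumes "i < n" "j < n"
  shows "\<exists>m'<n. trop_pow B m $$ (i, j) \<le> trop_pow B m' $$ (i, j)"
proof (induction m rule: less_induct)
  case (less m)
  then show ?case
    using pow_le_shorter[OF assms, of m] by (meson not_le_imp_less order_trans order.refl)
qed

lemma index_kleene_star: "i < n \<Longrightarrow> j < n \<Longrightarrow> kleene_star B $$ (i, j) = (SUP k. trop_pow B k $$ (i, j))"
  using carrier_matD[OF carrier] by (simp add: kleene_star_def)

text \<open>By \<open>pow_le_short\<close> the supremum over all exponents is a maximum over those
  below \<open>n\<close>. This bounds the lengths of the walks behind the entries of C and
  R.\<close>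

lemma kleene_star_attained:
  assumes "i < n" "j < n"
  obtains m where "m < n" "kleene_star B $$ (i, j) = trop_pow B m $$ (i, j)"
proof -
  obtain k where k: "k \<in> {0..<n}" "(SUP m\<in>{0..<n}. trop_pow B m $$ (i, j)) = trop_pow B k $$ (i, j)"
    by (rule SUP_finite_attained[of "{0..<n}" "\<lambda>m. trop_pow B m $$ (i, j)"]) (use assms in auto)
  have "trop_pow B m $$ (i, j) \<le> trop_pow B k $$ (i, j)" for m
    using pow_le_short[OF assms, of m] k(2) by (metis SUP_upper atLeast0LessThan lessThan_iff order_trans)
  then have "(SUP m. trop_pow B m $$ (i, j)) = trop_pow B k $$ (i, j)"
    by (intro antisym SUP_least SUP_upper) auto
  with k that[of k] index_kleene_star[OF assms] show ?thesis by auto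
qed

lemma walk_weight_le_edge:
  assumes "\<And>m. m \<le> t \<Longrightarrow> w m < n" "k < t"
  shows "walk_weight B w t \<le> B $$ (w k, w (Suc k))"
proof -
  obtain r where r: "t = k + 1 + r" using assms(2) by (metis Suc_eq_plus1 less_eq_Suc_le nat_le_iff_add)
  have "walk_weight B w t = walk_weight B w k + B $$ (w k, w (Suc k)) + walk_weight B (\<lambda>l. w (k + 1 + l)) r"
    unfolding r walk_weight_add by simp
  also have "\<dots> \<le> 0 + B $$ (w k, w (Suc k)) + 0"
    using assms r by (intro add_mono walk_weight_nonpos) auto
  finally show ?thesis by simp
qed

text \<open>In each block of \<open>n\<close> steps a node recurs, and the closed part in between
  has an edge of nonzero weight, since otherwise its node would lie on a closed walk of zero edges.
  By \<open>gap\<close> this edge alone brings the block down to \<open>- \<delta>\<close>.\<close>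

lemma walk_weight_decay:
  assumes gap: "\<And>i j. i < n \<Longrightarrow> j < n \<Longrightarrow> B $$ (i, j) = 0 \<or> B $$ (i, j) \<le> ereal (- \<delta>)"
    and w: "\<And>m. m \<le> n * q \<Longrightarrow> w m < n"
    and acyclic: "\<And>m. m \<le> n * q \<Longrightarrow> (w m, w m) \<notin> {(i, j). i < n \<and> j < n \<and> B $$ (i, j) = 0}\<^sup>+"
  shows "walk_weight B w (n * q) \<le> ereal (- \<delta> * q)"
  using w acyclic
proof (induction q arbitrary: w)
  case (Suc q)
  let ?Z = "{(i, j). i < n \<and> j < n \<and> B $$ (i, j) = 0}"
  have wn: "w m < n" if "m \<le> n" for m using Suc.prems(1)[of m] that by simp
  have "\<not> inj_on w {..n}"
    using card_inj_on_le[of w "{..n}" "{..<n}"] wn by fastforce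
  then obtain p p' where pq: "p < p'" "p' \<le> n" "w p = w p'"
    unfolding inj_on_def by (metis atMost_iff linorder_neqE_nat)
  have "\<exists>k<p' - p. (w (p + k), w (p + Suc k)) \<notin> ?Z"
  proof (rule ccontr)
    assume "\<not> ?thesis"
    then have "(w (p + 0), w (p + (p' - p))) \<in> ?Z\<^sup>+"
      using pq by (intro walk_in_trancl[of "p' - p" "\<lambda>m. w (p + m)"]) auto
    then show False using pq Suc.prems(2)[of p] by auto
  qed
  then obtain k' where "k' < p' - p" "(w (p + k'), w (p + Suc k')) \<notin> ?Z" by blast
  then obtain k where k: "k < n" "(w k, w (Suc k)) \<notin> ?Z"
    using pq by (intro that[of "p + k'"]) auto
  then have "B $$ (w k, w (Suc k)) \<le> ereal (- \<delta>)"
    using gap[of "w k" "w (Suc k)"] wn by auto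
  then have "walk_weight B w n \<le> ereal (- \<delta>)"
    using walk_weight_le_edge[of n w k] wn k by (meson order_trans)
  moreover have "walk_weight B (\<lambda>m. w (n + m)) (n * q) \<le> ereal (- \<delta> * q)"
    by (rule Suc.IH) (use Suc.prems in auto)
  ultimately have "walk_weight B w n + walk_weight B (\<lambda>m. w (n + m)) (n * q) \<le> ereal (- \<delta>) + ereal (- \<delta> * q)"
    by (rule add_mono)
  then show ?case by (simp add: walk_weight_add algebra_simps)
qed simp

end

section \<open>Lengths of closed walks and cyclicity\<close>

text \<open>The group generated by an additive monoid consists of differences, so \<open>g\<close>
  is a difference of two elements of \<open>L\<close>. From them two consecutive multiples of
  \<open>g\<close> in \<open>L\<close> arise, and these generate all large ones.\<close>

lemma additive_multiples_eventually:
  fixes L :: "nat set" and g :: nat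
  assumes zero: "0 \<in> L" and add: "\<And>a b. a \<in> L \<Longrightarrow> b \<in> L \<Longrightarrow> a + b \<in> L"
    and g: "int g \<in> group_closure (int ` L)"
  shows "\<exists>N. \<forall>m\<ge>N. g * m \<in> L"
proof -
  have mult: "k * a \<in> L" if "a \<in> L" for k a
    by (induction k) (use that zero add in auto)
  have "\<exists>a b. a \<in> L \<and> b \<in> L \<and> z = int a - int b" if "z \<in> group_closure (int ` L)" for z
    using that
  proof induction
    case (base z)
    then show ?case using zero by (metis diff_zero image_iff insert_iff of_nat_0)
  next
    case (diff y z)
    then obtain a b c d where "a \<in> L" "b \<in> L" "y = int a - int b" "c \<in> L" "d \<in> L" "z = int c - int d"
      by blast
    then show ?case by (intro exI[of _ "a + d"] exI[of _ "b + c"]) (simp add: add)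
  qed
  then obtain a b where ab: "a \<in> L" "b \<in> L" "int g = int a - int b"
    using g by blast
  show ?thesis
  proof (cases "g = 0 \<or> b = 0")
    case True
    \<comment> \<open>\<open>g = 0\<close> is covered by \<open>zero\<close>, and
      \<open>b = 0\<close> makes \<open>g\<close> equal to \<open>a\<close>.\<close>
    then have "g \<in> L" using ab zero by auto
    then show ?thesis using mult by (metis mult.commute)
  next
    case False
    have a: "a = b + g" using ab(3) by linarith
    have "g * b \<in> L" using ab mult by simp
    (* g * b and g * (b + 1) both lie in L, and every m >= b^2 is a nonnegative combination of b and b + 1. *)
    have "g * b + g = (g - 1) * b + a"
      using False a by (cases g) (auto simp: algebra_simps)
    then have "g * (b + 1) \<in> L" using ab mult add by (metis add_mult_distrib2 mult.right_neutral)
    show ?thesis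
    proof (intro exI allI impI)
      fix m assume m: "b * b \<le> m"
      define u v where "u = m div b" and "v = m mod b"
      have "v < b" using False by (simp add: v_def)
      have "b \<le> u" using m False by (simp add: u_def less_eq_div_iff_mult_less_eq)
      have "m = u * b + v" by (simp add: u_def v_def)
      \<comment> \<open>Since \<open>v < b\<close> and \<open>b \<le> u\<close>, the natural-number
        difference \<open>u - v\<close> is not truncated.\<close>
      also have "\<dots> = (u - v) * b + v * (b + 1)"
        using \<open>v < b\<close> \<open>b \<le> u\<close> by (simp add: algebra_simps flip: add_mult_distrib)
      finally have "g * m = (u - v) * (g * b) + v * (g * (b + 1))"
        by (simp add: algebra_simps)
      then show "g * m \<in> L"
        using mult add \<open>g * b \<in> L\<close> \<open>g * (b + 1) \<in> L\<close> by simp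
    qed
  qed
qed

section \<open>Closed walks and cycles in strongly connected components\<close>

context wf_digraph
begin

text \<open>A closed walk from \<open>k\<close> to the cycle and back can go round the cycle or not; its length is the difference.\<close>

lemma scc_cycle_length_in_group_closure:
  assumes H: "H \<in> sccs" and k: "k \<in> verts H" and p: "pre_digraph.cycle H p"
  shows "int (length p) \<in> group_closure (int ` length ` {q. awalk k q k})"
proof -
  have ind: "induced_subgraph H G" "strongly_connected H" using H by auto
  then have sub: "subgraph H G" by auto
  interpret H: wf_digraph H using sub by (auto simp: subgraph_def)
  obtain u where u: "H.awalk u p u" using p by (auto simp: H.cycle_def)
  then have "u \<in> verts H" by auto
  then obtain q r where "H.awalk k q u" "H.awalk u r k"
    using k ind(2) by (meson H.reachable_awalk strongly_connectedE)
  then have q: "awalk k q u" and r: "awalk u r k" and p: "awalk u p u"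
    using u sub subgraph_awalk_imp_awalk by blast+
  have "awalk k (q @ r) k" "awalk k (q @ p @ r) k"
    using p q r by auto
  then have "int (length (q @ p @ r)) - int (length (q @ r)) \<in> group_closure (int ` length ` {q. awalk k q k})"
    by (intro group_closure.diff group_closure.base) blast+
  then show ?thesis by simp
qed

text \<open>The cycle lengths in the component of \<open>k\<close>, hence also their gcd and its
  multiple \<open>cyclicity G\<close>, lie in the group generated by the lengths of closed walks at
  \<open>k\<close>. These lengths are closed under addition, so all large multiples occur among
  them.\<close>

lemma cyclicity_multiples_closed_walks:
  assumes "k \<in> verts G"
  shows "\<exists>N. \<forall>m\<ge>N. \<exists>p. awalk k p k \<and> length p = cyclicity G * m"
proof -
  let ?L = "length ` {q. awalk k q k}"
  obtain H where H: "H \<in> sccs" "k \<in> verts H"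
    using scc_of_in_sccs_verts[OF assms] in_scc_of_self[OF assms] by (auto simp: sccs_verts_conv)
  let ?P = "length ` {p. pre_digraph.cycle H p}"
  have "group_closure (int ` ?P) \<subseteq> group_closure (int ` ?L)"
  proof
    fix z assume "z \<in> group_closure (int ` ?P)"
    then show "z \<in> group_closure (int ` ?L)"
      by induction (auto intro: group_closure.diff scc_cycle_length_in_group_closure[OF H])
  qed
  then have "int (Gcd ?P) \<in> group_closure (int ` ?L)"
    using Gcd_in_group_closure[of "int ` ?P"] by (auto simp: Gcd_int_eq)
  moreover have "Gcd ?P dvd cyclicity G"
    unfolding cyclicity_def using H(1) by (intro dvd_Lcm) auto
  ultimately have "int (cyclicity G) \<in> group_closure (int ` ?L)"
    by (auto elim!: dvdE intro: group_closure_mult_left)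
  then have "\<exists>N. \<forall>m\<ge>N. cyclicity G * m \<in> ?L"
  proof (rule additive_multiples_eventually[rotated 2])
    show "0 \<in> ?L" using assms by (auto simp: image_iff awalk_Nil_iff)
    show "a + b \<in> ?L" if ab: "a \<in> ?L" "b \<in> ?L" for a b
    proof -
      obtain p q where "awalk k p k" "a = length p" "awalk k q k" "b = length q" using ab by auto
      then show ?thesis by (intro image_eqI[of _ _ "p @ q"]) auto
    qed
  qed
  then show ?thesis by (metis (mono_tags, lifting) imageE mem_Collect_eq)
qed

text \<open>The first edge of a closed walk at \<open>u\<close> stays in the component, because its
  head leads back to \<open>u\<close>. A simple path in \<open>H\<close> from that head to
  \<open>u\<close> completes it to a simple cycle.\<close>

lemma scc_contains_cycle:
  assumes H: "H \<in> sccs" and closed: "\<And>u. u \<in> verts G \<Longrightarrow> \<exists>p. p \<noteq> [] \<and> awalk u p u"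
  shows "\<exists>p. pre_digraph.cycle H p"
proof -
  have ind: "induced_subgraph H G" "strongly_connected H" using H by auto
  then have sub: "subgraph H G" by auto
  interpret H: wf_digraph H using sub by (auto simp: subgraph_def)
  obtain u where u: "u \<in> verts H" using ind(2) by (auto simp: strongly_connected_def)
  then have "u \<in> verts G" using sub by auto
  then obtain p where "p \<noteq> []" "awalk u p u" using closed by blast
  then obtain e q where e: "e \<in> arcs G" "tail G e = u" "awalk (head G e) q u"
    by (cases p) (auto simp: awalk_Cons_iff)
  then have "u \<rightarrow>\<^sup>* head G e" "head G e \<rightarrow>\<^sup>* u"
    by (auto simp: reachable_awalk intro: exI[of _ "[e]"] arc_implies_awalk)
  moreover have "verts H \<in> sccs_verts" using H by (auto simp: sccs_verts_conv)
  ultimately have hd: "head G e \<in> verts H"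
    using u unfolding in_sccs_verts_conv_reachable by blast
  have "tail H = tail G" "head H = head G" "arcs H = {e \<in> arcs G. tail G e \<in> verts H \<and> head G e \<in> verts H}"
    using compatible_tail[of G H] compatible_head[of G H] sub ind(1)
    unfolding induced_subgraph_def subgraph_def by metis+
  then have eH: "e \<in> arcs H" "tail H e = u" "head H e = head G e"
    using hd u e by simp_all
  obtain r where r: "H.apath (head G e) r u"
    using ind(2) hd u by (meson H.reachable_apath strongly_connectedE)
  then have "H.cycle (e # r)"
    unfolding H.cycle_def using eH by (auto simp: H.awalk_Cons_iff H.apath_def)
  then show ?thesis by blast
qed

end

text \<open>Positivity could fail in two ways: \<open>Gcd\<close> of a set without positive elements
  is \<open>0\<close>, and so is \<open>Lcm\<close> of an infinite set of naturals. A cycle in each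
  component rules out the first, finiteness of the graph the second.\<close>

lemma (in fin_digraph) cyclicity_pos:
  assumes "\<And>u. u \<in> verts G \<Longrightarrow> \<exists>p. p \<noteq> [] \<and> awalk u p u"
  shows "0 < cyclicity G"
proof -
  have "Gcd (length ` {p. pre_digraph.cycle H p}) \<noteq> 0" if H: "H \<in> sccs" for H
  proof -
    obtain p where p: "pre_digraph.cycle H p" using scc_contains_cycle[OF H assms] by blast
    then have "p \<noteq> []" unfolding pre_digraph.cycle_def by blast
    with p show ?thesis by (auto simp: Gcd_0_iff)
  qed
  moreover have "finite sccs" using finite_sccs_verts by (simp add: sccs_conv_sccs_verts)
  ultimately show ?thesis
    unfolding cyclicity_def by (subst neq0_conv[symmetric], subst Lcm_0_iff) auto
qed

text \<open>Powers of the edge relation serve as common language for critical walks and for powers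
  of S. The vertex assumption concerns length \<open>0\<close>, where the relation power is the full
  identity but an empty walk needs a vertex.\<close>

lemma (in pair_wf_digraph) relpow_iff_awalk:
  assumes "u \<in> pverts G"
  shows "(u, v) \<in> parcs G ^^ m \<longleftrightarrow> (\<exists>p. awalk u p v \<and> length p = m)"
  using assms
proof (induction m arbitrary: u)
  case 0
  then show ?case by (auto simp: awalk_Nil_iff)
next
  case (Suc m)
  have "(u, v) \<in> parcs G ^^ Suc m \<longleftrightarrow> (\<exists>w. (u, w) \<in> parcs G \<and> (w, v) \<in> parcs G ^^ m)"
    by (meson relpow_Suc_D2 relpow_Suc_I2)
  also have "\<dots> \<longleftrightarrow> (\<exists>w p. (u, w) \<in> parcs G \<and> awalk w p v \<and> length p = m)"
    using Suc.IH in_arcsD2 by blast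
  also have "\<dots> \<longleftrightarrow> (\<exists>p. awalk u p v \<and> length p = Suc m)"
    (is "?L \<longleftrightarrow> ?R")
  proof
    assume ?L
    then obtain w p where "(u, w) \<in> parcs G" "awalk w p v" "length p = m" by blast
    then show ?R using Suc.prems by (intro exI[of _ "(u, w) # p"]) (simp add: awalk_Cons_iff)
  next
    assume ?R
    then show ?L by (auto simp: length_Suc_conv awalk_Cons_iff) blast
  qed
  finally show ?case .
qed

text \<open>A long closed walk at \<open>k\<close>, of length a multiple of the cyclicity, is put
  before one walk from \<open>k\<close> to \<open>l\<close> of the right residue.\<close>

lemma (in pair_fin_digraph) relpow_eventually_periodic:
  assumes pos: "0 < cyclicity G"
  shows "\<exists>T. \<forall>s\<ge>T. \<forall>k\<in>pverts G. \<forall>l\<in>pverts G. \<forall>t.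
    (k, l) \<in> parcs G ^^ t \<longrightarrow> s mod cyclicity G = t mod cyclicity G \<longrightarrow> (k, l) \<in> parcs G ^^ s"
proof -
  let ?E = "parcs G" and ?g = "cyclicity G"
  have "\<forall>\<^sub>F s in sequentially. (\<exists>t. (k, l) \<in> ?E ^^ t \<and> t mod ?g = r) \<longrightarrow> s mod ?g = r \<longrightarrow> (k, l) \<in> ?E ^^ s"
    if kl: "k \<in> pverts G" for k l r
  proof (cases "\<exists>t. (k, l) \<in> ?E ^^ t \<and> t mod ?g = r")
    case True
    then obtain t where t: "(k, l) \<in> ?E ^^ t" "t mod ?g = r" by blast
    obtain N where N: "\<And>m. m \<ge> N \<Longrightarrow> (k, k) \<in> ?E ^^ (?g * m)"
      using cyclicity_multiples_closed_walks[of k] kl relpow_iff_awalk[of k k] by auto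
    show ?thesis
      unfolding eventually_sequentially
    proof (intro exI allI impI)
      fix s assume s: "?g * N + t \<le> s" "s mod ?g = r"
      moreover have "t \<le> s" using s by simp
      ultimately have "?g dvd s - t" using t by (metis mod_eq_dvd_iff_nat)
      then obtain m where m: "s - t = ?g * m" by blast
      with s have "?g * N \<le> ?g * m" by linarith
      then have "(k, k) \<in> ?E ^^ (?g * m)" using N pos by simp
      then have "(k, l) \<in> ?E ^^ (?g * m + t)" using t by (auto simp: relpow_add)
      moreover have "?g * m + t = s" using m s by linarith
      ultimately show "(k, l) \<in> ?E ^^ s" by simp
    qed
  qed auto
  \<comment> \<open>Only the residue \<open>r\<close> of \<open>t\<close> enters, so finitely many
    triples \<open>(k, l, r)\<close> share one threshold.\<close>
  then have "\<forall>\<^sub>F s in sequentially. \<forall>(k, l, r)\<in>pverts G \<times> pverts G \<times> {..<?g}.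
      (\<exists>t. (k, l) \<in> ?E ^^ t \<and> t mod ?g = r) \<longrightarrow> s mod ?g = r \<longrightarrow> (k, l) \<in> ?E ^^ s"
    by (intro eventually_ball_finite) auto
  then obtain T where "\<And>s k l r. s \<ge> T \<Longrightarrow> k \<in> pverts G \<Longrightarrow> l \<in> pverts G \<Longrightarrow> r < ?g \<Longrightarrow>
      (\<exists>t. (k, l) \<in> ?E ^^ t \<and> t mod ?g = r) \<Longrightarrow> s mod ?g = r \<Longrightarrow> (k, l) \<in> ?E ^^ s"
    unfolding eventually_sequentially by fastforce
  then show ?thesis using pos by (metis mod_less_divisor)
qed

section \<open>Critical walks and the CSR decomposition\<close>

lemma (in nonpos_mat) negative_entry_gap:
  "\<exists>\<delta>>0. \<forall>i<n. \<forall>j<n. B $$ (i, j) = 0 \<or> B $$ (i, j) \<le> ereal (- \<delta>)"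
proof -
  \<comment> \<open>The extra element \<open>-1\<close> keeps the set nonempty and its maximum above
    \<open>-\<infinity>\<close>.\<close>
  define V where "V = insert (-1) {v \<in> (\<lambda>(i, j). B $$ (i, j)) ` ({..<n} \<times> {..<n}). v \<noteq> 0}"
  have fin: "finite V" "V \<noteq> {}" by (simp_all add: V_def)
  have "Max V < 0" unfolding Max_less_iff[OF fin] by (auto simp: V_def nonpos order_less_le)
  moreover have "-1 \<le> Max V" using fin by (intro Max_ge) (simp_all add: V_def)
  ultimately obtain d where d: "Max V = ereal d" "d < 0"
    by (cases "Max V") auto
  have "B $$ (i, j) = 0 \<or> B $$ (i, j) \<le> ereal d" if "i < n" "j < n" for i j
    using that fin unfolding d(1)[symmetric] by (auto simp: V_def intro!: Max_ge)
  with d(2) show ?thesis by (intro exI[of _ "- d"]) auto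
qed

text \<open>At weight \<open>-1\<close> the cut-off hides a walk: adding an entry of the vector,
  which is at most \<open>1\<close>, leaves at most \<open>0\<close>. With
  \<open>1 / \<delta> \<le> q\<close>, the decay over \<open>q\<close> blocks of \<open>n\<close>
  steps suffices.\<close>

lemma (in nonpos_mat) walk_weight_eventually_le:
  "\<exists>T. \<forall>t\<ge>T. \<forall>w. (\<forall>m\<le>t. w m < n \<and> (w m, w m) \<notin> {(i, j). i < n \<and> j < n \<and> B $$ (i, j) = 0}\<^sup>+)
    \<longrightarrow> walk_weight B w t \<le> -1"
proof -
  obtain \<delta> where \<delta>: "0 < \<delta>" "\<And>i j. i < n \<Longrightarrow> j < n \<Longrightarrow> B $$ (i, j) = 0 \<or> B $$ (i, j) \<le> ereal (- \<delta>)"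
    using negative_entry_gap by blast
  obtain q :: nat where q: "1 / \<delta> \<le> q" using real_arch_simple by blast
  show ?thesis
  proof (intro exI allI impI)
    fix t w
    assume t: "n * q \<le> t"
      and w: "\<forall>m\<le>t. w m < n \<and> (w m, w m) \<notin> {(i, j). i < n \<and> j < n \<and> B $$ (i, j) = 0}\<^sup>+"
    obtain r where r: "t = n * q + r" using t nat_le_iff_add by blast
    have "walk_weight B w t \<le> walk_weight B w (n * q) + 0"
      using w unfolding r walk_weight_add by (intro add_left_mono walk_weight_nonpos) simp
    also have "\<dots> \<le> ereal (- \<delta> * q) + 0"
      using w r by (intro add_right_mono walk_weight_decay \<delta>(2)) auto
    also have "\<dots> \<le> -1"
      using q \<delta>(1) by (simp add: field_simps one_ereal_def)
    finally show "walk_weight B w t \<le> -1" .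
  qed
qed

text \<open>A matrix with entries \<open>0\<close> and \<open>-\<infinity>\<close> encodes a
  relation, and its tropical product is relational composition. The inclusion for \<open>E\<close>
  keeps intermediate nodes in the range of the supremum.\<close>

lemma index_trop_pow_relpow:
  assumes S: "S \<in> carrier_mat c c"
    and index: "\<And>i j. i < c \<Longrightarrow> j < c \<Longrightarrow> S $$ (i, j) = (if (i, j) \<in> E then 0 else -\<infinity>)"
    and E: "E \<subseteq> {..<c} \<times> {..<c}"
  shows "i < c \<Longrightarrow> j < c \<Longrightarrow> trop_pow S t $$ (i, j) = (if (i, j) \<in> E ^^ t then 0 else -\<infinity>)"
proof (induction t arbitrary: j)
  case 0
  then show ?case by (simp add: index_trop_pow_0[OF S] del: trop_pow.simps)
next
  case (Suc t)
  have eq: "trop_pow S (Suc t) $$ (i, j) = (SUP l\<in>{0..<c}. if (i, l) \<in> E ^^ t \<and> (l, j) \<in> E then 0 else -\<infinity>)"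
    unfolding index_trop_pow_Suc[OF S Suc.prems] using Suc by (intro SUP_cong) (auto simp: index)
  show ?case
  proof (cases "(i, j) \<in> E ^^ Suc t")
    case True
    then obtain l where "(i, l) \<in> E ^^ t" "(l, j) \<in> E" by auto
    with E have "0 \<le> (SUP l\<in>{0..<c}. if (i, l) \<in> E ^^ t \<and> (l, j) \<in> E then 0 else (-\<infinity> :: ereal))"
      by (intro SUP_upper2[of l]) auto
    moreover have "(SUP l\<in>{0..<c}. if (i, l) \<in> E ^^ t \<and> (l, j) \<in> E then 0 else (-\<infinity> :: ereal)) \<le> 0"
      by (intro SUP_least) auto
    ultimately show ?thesis using True unfolding eq by (simp del: relpow.simps)
  next
    case False
    then have "(SUP l\<in>{0..<c}. if (i, l) \<in> E ^^ t \<and> (l, j) \<in> E then 0 else (-\<infinity> :: ereal)) \<le> -\<infinity>"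
      by (intro SUP_least) auto
    then show ?thesis using False unfolding eq by (simp del: relpow.simps)
  qed
qed

text \<open>Abstracts the critical graph: \<open>E\<close> stands for its edges, \<open>g\<close>
  for its cyclicity and \<open>T0\<close> for the threshold of its periodicity. By
  \<open>noncritical\<close>, closed walks of zero edges visit only nodes below
  \<open>c\<close>.\<close>

locale critical_relation = nonpos_mat n B for n B +
  fixes E :: "(nat \<times> nat) set" and c g T0 :: nat
  assumes c_le: "c \<le> n"
    and E_zero: "\<And>i j. (i, j) \<in> E \<Longrightarrow> i < c \<and> j < c \<and> B $$ (i, j) = 0"
    and E_cyclic: "\<And>k. k < c \<Longrightarrow> (k, k) \<in> E\<^sup>+"
    and noncritical: "\<And>k. c \<le> k \<Longrightarrow> k < n \<Longrightarrow> (k, k) \<notin> {(i, j). i < n \<and> j < n \<and> B $$ (i, j) = 0}\<^sup>+"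
    and g_pos: "0 < g"
    and periodic: "\<And>s t k l. T0 \<le> s \<Longrightarrow> k < c \<Longrightarrow> l < c \<Longrightarrow> (k, l) \<in> E ^^ t \<Longrightarrow> s mod g = t mod g
      \<Longrightarrow> (k, l) \<in> E ^^ s"
begin

section \<open>Star entries and critical walks\<close>

abbreviation star :: "nat \<Rightarrow> nat \<Rightarrow> ereal" where
  "star i j \<equiv> kleene_star (trop_pow B g) $$ (i, j)"

lemma star_ge: "i < n \<Longrightarrow> j < n \<Longrightarrow> trop_pow B (g * m) $$ (i, j) \<le> star i j"
  by (subst nonpos_mat.index_kleene_star[OF nonpos_mat_pow]) (auto simp: pow_pow[symmetric] intro: SUP_upper)

lemma star_attained:
  assumes "i < n" "j < n"
  obtains m where "m < n" "star i j = trop_pow B (g * m) $$ (i, j)"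
  using nonpos_mat.kleene_star_attained[OF nonpos_mat_pow assms] pow_pow[OF assms] by metis

lemma star_nonpos: "i < n \<Longrightarrow> j < n \<Longrightarrow> star i j \<le> 0"
  by (metis star_attained pow_nonpos)

lemma star_refl: "i < n \<Longrightarrow> 0 \<le> star i i"
  using star_ge[of i i 0] by (simp add: pow_0 del: trop_pow.simps)

lemma relpow_less: "(k, l) \<in> E ^^ t \<Longrightarrow> k < c \<Longrightarrow> l < c"
  by (induction t arbitrary: l) (auto dest: E_zero)

lemma relpow_pow_ge: "(k, l) \<in> E ^^ t \<Longrightarrow> k < c \<Longrightarrow> 0 \<le> trop_pow B t $$ (k, l)"
proof (induction t arbitrary: l)
  case 0
  then show ?case using c_le by (simp add: pow_0 del: trop_pow.simps)
next
  case (Suc t)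
  then obtain m where m: "(k, m) \<in> E ^^ t" "(m, l) \<in> E" by auto
  then show ?case
    using pow_Suc_ge[of k l m t] Suc E_zero[OF m(2)] c_le by (auto intro: order_trans simp del: trop_pow.simps)
qed

text \<open>The star entries are attained by walks of lengths \<open>g * a\<close> and
  \<open>g * b\<close> with \<open>a\<close> and \<open>b\<close> below \<open>n\<close>. Removing
  these lengths from \<open>t\<close> keeps its residue and leaves at least \<open>T0\<close>, so
  periodicity supplies a critical walk of exactly the missing length.\<close>

lemma star_relpow_star_le_pow:
  assumes t: "T0 + 2 * (n * g) \<le> t" and ij: "i < n" "j < n" and kl: "k < c" "l < c" "(k, l) \<in> E ^^ t"
  shows "star i k + star l j \<le> trop_pow B t $$ (i, j)"
proof -
  have n: "k < n" "l < n" using kl c_le by auto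
  obtain a b where a: "a < n" "star i k = trop_pow B (g * a) $$ (i, k)"
    and b: "b < n" "star l j = trop_pow B (g * b) $$ (l, j)"
    using star_attained ij n by metis
  define s where "s = t - (g * a + g * b)"
  have "g * a \<le> n * g" "g * b \<le> n * g" using a b by (simp_all add: mult.commute)
  then have s: "T0 \<le> s" "t = g * a + s + g * b" using t unfolding s_def by linarith+
  have "s mod g = t mod g" unfolding s(2) by simp
  then have "(k, l) \<in> E ^^ s" using periodic kl s by blast
  then have "0 \<le> trop_pow B s $$ (k, l)" using relpow_pow_ge kl by blast
  then have "star i k + star l j \<le> trop_pow B (g * a) $$ (i, k) + trop_pow B s $$ (k, l) + trop_pow B (g * b) $$ (l, j)"
    unfolding a(2) b(2) by (metis add.right_neutral add_left_mono add_right_mono)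
  also have "\<dots> \<le> trop_pow B (g * a + s) $$ (i, l) + trop_pow B (g * b) $$ (l, j)"
    using ij n by (intro add_right_mono pow_supermult)
  also have "\<dots> \<le> trop_pow B t $$ (i, j)"
    unfolding s(2) using ij n by (intro pow_supermult)
  finally show ?thesis .
qed

lemma critical_closed_walk:
  assumes "k < c"
  obtains L where "0 < L" "\<And>m. (k, k) \<in> E ^^ (m * L)"
proof -
  obtain L where L: "0 < L" "(k, k) \<in> E ^^ L" using E_cyclic[OF assms] by (auto simp: trancl_power)
  have "(k, k) \<in> E ^^ (m * L)" for m
    by (induction m) (use L in \<open>auto simp: relpow_add\<close>)
  with L(1) that show ?thesis by blast
qed

lemma extend_to_star_right:
  assumes i: "i < n" and k: "k < c"
  obtains k' s where "k' < c" "(k', k) \<in> E ^^ s" "s mod g = p mod g" "trop_pow B p $$ (i, k) \<le> star i k'"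
proof -
  obtain L where L: "0 < L" "\<And>m. (k, k) \<in> E ^^ (m * L)" using critical_closed_walk[OF k] by blast
  (* r steps from k bring the length of the first part to g * p; the remaining s steps lead back to k. *)
  define r s where "r = (g - 1) * p" and "s = g * p * L - r"
  have rp: "p + r = g * p" using g_pos by (cases g) (simp_all add: r_def)
  have "g * p * 1 \<le> g * p * L" using L(1) by (intro mult_left_mono) auto
  then have "r \<le> g * p * L" using rp by linarith
  then have rs: "g * p * L = r + s" by (simp add: s_def)
  then obtain k' where k': "(k, k') \<in> E ^^ r" "(k', k) \<in> E ^^ s"
    using L(2)[of "g * p"] by (auto simp: relpow_add)
  then have "k' < c" using relpow_less k by blast
  \<comment> \<open>\<open>r + s\<close> is a multiple of \<open>g\<close> and \<open>r\<close> is
    congruent to \<open>- p\<close>, so \<open>s\<close> is congruent to \<open>p\<close> modulo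
    \<open>g\<close>.\<close>
  have "s + g * p = p + g * (p * L)" using rp rs by (simp add: algebra_simps)
  then have "s mod g = p mod g" by (metis mod_mult_self2)
  have "trop_pow B p $$ (i, k) + 0 \<le> trop_pow B p $$ (i, k) + trop_pow B r $$ (k, k')"
    using relpow_pow_ge[OF k'(1) k] by (intro add_left_mono)
  also have "\<dots> \<le> trop_pow B (g * p) $$ (i, k')"
    unfolding rp[symmetric] using i k \<open>k' < c\<close> c_le by (intro pow_supermult) auto
  also have "\<dots> \<le> star i k'" using i \<open>k' < c\<close> c_le by (intro star_ge) auto
  finally show ?thesis using that \<open>k' < c\<close> k'(2) \<open>s mod g = p mod g\<close> by simp
qed

text \<open>Mirror image of \<open>extend_to_star_right\<close>: the last \<open>r\<close> edges of
  the closed critical walk are put before the walk leaving \<open>k\<close>.\<close>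

lemma extend_to_star_left:
  assumes j: "j < n" and k: "k < c"
  obtains l s where "l < c" "(k, l) \<in> E ^^ s" "s mod g = q mod g" "trop_pow B q $$ (k, j) \<le> star l j"
proof -
  obtain L where L: "0 < L" "\<And>m. (k, k) \<in> E ^^ (m * L)" using critical_closed_walk[OF k] by blast
  define r s where "r = (g - 1) * q" and "s = g * q * L - r"
  have rq: "r + q = g * q" using g_pos by (cases g) (simp_all add: r_def)
  have "g * q * 1 \<le> g * q * L" using L(1) by (intro mult_left_mono) auto
  then have "r \<le> g * q * L" using rq by linarith
  then have rs: "g * q * L = s + r" by (simp add: s_def)
  then obtain l where l: "(k, l) \<in> E ^^ s" "(l, k) \<in> E ^^ r"
    using L(2)[of "g * q"] by (auto simp: relpow_add)
  then have "l < c" using relpow_less k by blast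
  have "s + g * q = q + g * (q * L)" using rq rs by (simp add: algebra_simps)
  then have "s mod g = q mod g" by (metis mod_mult_self2)
  have "0 + trop_pow B q $$ (k, j) \<le> trop_pow B r $$ (l, k) + trop_pow B q $$ (k, j)"
    using relpow_pow_ge[OF l(2) \<open>l < c\<close>] by (intro add_right_mono)
  also have "\<dots> \<le> trop_pow B (g * q) $$ (l, j)"
    unfolding rq[symmetric] using j k \<open>l < c\<close> c_le by (intro pow_supermult) auto
  also have "\<dots> \<le> star l j" using j \<open>l < c\<close> c_le by (intro star_ge) auto
  finally show ?thesis using that \<open>l < c\<close> l(1) \<open>s mod g = q mod g\<close> by simp
qed

text \<open>The two extensions leave a critical walk from \<open>k'\<close> through \<open>k\<close>
  to \<open>l\<close> whose length is congruent to \<open>p + q\<close>; periodicity replaces it by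
  one of length \<open>p + q\<close>.\<close>

lemma pow_through_critical_le:
  assumes "T0 \<le> p + q" "i < n" "j < n" "k < c"
  obtains k' l where "k' < c" "l < c" "(k', l) \<in> E ^^ (p + q)"
    "trop_pow B p $$ (i, k) + trop_pow B q $$ (k, j) \<le> star i k' + star l j"
proof -
  obtain k' s where k': "k' < c" "(k', k) \<in> E ^^ s" "s mod g = p mod g" "trop_pow B p $$ (i, k) \<le> star i k'"
    using extend_to_star_right assms by blast
  obtain l r where l: "l < c" "(k, l) \<in> E ^^ r" "r mod g = q mod g" "trop_pow B q $$ (k, j) \<le> star l j"
    using extend_to_star_left assms by blast
  have "(k', l) \<in> E ^^ (s + r)" using k' l by (auto simp: relpow_add)
  moreover have "(p + q) mod g = (s + r) mod g" using k'(3) l(3) by (metis mod_add_eq)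
  ultimately have "(k', l) \<in> E ^^ (p + q)" using periodic assms(1) k' l by blast
  then show ?thesis using that k' l by (meson add_mono)
qed

text \<open>With a critical row index the whole walk is absorbed into one star entry, so no factor C
  arises; this yields the second formula.\<close>

lemma pow_critical_row_le:
  assumes "T0 \<le> t" "i < c" "j < n"
  obtains l where "l < c" "(i, l) \<in> E ^^ t" "trop_pow B t $$ (i, j) \<le> star l j"
proof -
  obtain l r where "l < c" "(i, l) \<in> E ^^ r" "r mod g = t mod g" "trop_pow B t $$ (i, j) \<le> star l j"
    using extend_to_star_left assms by blast
  with that show ?thesis using periodic assms by (metis)
qed

end

section \<open>Comparison of powers with the CSR product\<close>

context critical_relation
begin

text \<open>Entry \<open>(i, j)\<close> of the product of C, the \<open>t\<close>-th power of S, and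
  R, with the suprema nested as the left-associated matrix product produces them.\<close>

abbreviation csr_entry :: "nat \<Rightarrow> nat \<Rightarrow> nat \<Rightarrow> ereal" where
  "csr_entry t i j \<equiv>
    (SUP l\<in>{0..<c}. (SUP k\<in>{0..<c}. star i k + (if (k, l) \<in> E ^^ t then 0 else -\<infinity>)) + star l j)"

lemma csr_entry_ge:
  assumes "k < c" "l < c" "(k, l) \<in> E ^^ t"
  shows "star i k + star l j \<le> csr_entry t i j"
  using assms by (intro SUP_upper2[of l] add_right_mono SUP_upper2[of k]) auto

lemma csr_entry_le_pow:
  assumes t: "T0 + 2 * (n * g) \<le> t" and ij: "i < n" "j < n"
  shows "csr_entry t i j \<le> trop_pow B t $$ (i, j)"
proof (rule SUP_least)
  fix l assume l: "l \<in> {0..<c}"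
  define f where "f k = star i k + (if (k, l) \<in> E ^^ t then 0 else -\<infinity>)" for k
  obtain k where k: "k \<in> {0..<c}" "(SUP k\<in>{0..<c}. f k) = f k"
    by (rule SUP_finite_attained[of "{0..<c}" f]) (use l in auto)
  have "f k + star l j \<le> trop_pow B t $$ (i, j)"
  proof (cases "(k, l) \<in> E ^^ t")
    case True
    then show ?thesis using star_relpow_star_le_pow[OF t ij] k l by (simp add: f_def)
  next
    case False
    \<comment> \<open>Here \<open>-\<infinity>\<close> is absorbing because nonpositive star entries
      are not \<open>\<infinity>\<close>.\<close>
    moreover have "star i k + -\<infinity> + star l j = -\<infinity>"
      using star_nonpos[of i k] star_nonpos[of l j] ij k l c_le
      by (cases "star i k"; cases "star l j") auto
    ultimately have "f k + star l j = -\<infinity>" unfolding f_def by (simp only: if_False)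
    then show ?thesis by (rule eq_refl[THEN order_trans]) simp
  qed
  then show "(SUP k\<in>{0..<c}. star i k + (if (k, l) \<in> E ^^ t then 0 else -\<infinity>)) + star l j \<le> trop_pow B t $$ (i, j)"
    using k(2) by (simp add: f_def)
qed

text \<open>For large \<open>t\<close> an optimal walk either meets a node below \<open>c\<close>
  and is split there, or has decayed to weight at most \<open>-1\<close>.\<close>

lemma pow_eventually_le_csr_entry:
  "\<exists>T. \<forall>t\<ge>T. \<forall>i<n. \<forall>j<n. trop_pow B t $$ (i, j) \<le> max (csr_entry t i j) (-1)"
proof -
  let ?Z = "{(i, j). i < n \<and> j < n \<and> B $$ (i, j) = 0}"
  obtain T where T: "\<And>t w. T \<le> t \<Longrightarrow> (\<forall>m\<le>t. w m < n \<and> (w m, w m) \<notin> ?Z\<^sup>+) \<Longrightarrow> walk_weight B w t \<le> -1"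
    using walk_weight_eventually_le by blast
  show ?thesis
  proof (intro exI allI impI)
    fix t i j assume t: "max T T0 \<le> t" and ij: "i < n" "j < n"
    show "trop_pow B t $$ (i, j) \<le> max (csr_entry t i j) (-1)"
    proof (cases "trop_pow B t $$ (i, j) = -\<infinity>")
      case True
      then show ?thesis by simp
    next
      case False
      then obtain w where w: "w 0 = i" "w t = j" "\<forall>m\<le>t. w m < n" "walk_weight B w t = trop_pow B t $$ (i, j)"
        using pow_walk ij by blast
      show ?thesis
      proof (cases "\<exists>m\<le>t. w m < c")
        case True
        then obtain p q where pq: "t = p + q" "w p < c" by (metis nat_le_iff_add)
        have "trop_pow B t $$ (i, j) \<le> trop_pow B p $$ (i, w p) + trop_pow B q $$ (w p, j)"
          using walk_weight_le_split[of p q w] w pq(1) by simp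
        moreover obtain k l where "k < c" "l < c" "(k, l) \<in> E ^^ t"
          "trop_pow B p $$ (i, w p) + trop_pow B q $$ (w p, j) \<le> star i k + star l j"
          using pow_through_critical_le[of p q i j "w p"] t ij pq by auto
        ultimately show ?thesis
          using csr_entry_ge[of k l t i j] by (meson max.coboundedI1 order_trans)
      next
        case False
        then have "walk_weight B w t \<le> -1"
          using w(3) noncritical t by (intro T) (auto simp: not_less)
        then show ?thesis using w(4) by (simp add: max.coboundedI2)
      qed
    qed
  qed
qed

text \<open>Where only the bound \<open>-1\<close> is available, the summand is at most
  \<open>0\<close> because \<open>x j \<le> 1\<close>, so the maximum with \<open>0\<close> hides
  it. The threshold does not depend on \<open>x\<close>.\<close>

lemma pow_vec_eventually_eq_csr:
  "\<exists>T. \<forall>t\<ge>T. \<forall>x :: nat \<Rightarrow> real. (\<forall>j<n. x j \<le> 1) \<longrightarrow> (\<forall>i<n.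
    max 0 (SUP j\<in>{0..<n}. trop_pow B t $$ (i, j) + ereal (x j))
      = max (SUP j\<in>{0..<n}. csr_entry t i j + ereal (x j)) 0)"
proof -
  obtain T where T: "\<And>t i j. T \<le> t \<Longrightarrow> i < n \<Longrightarrow> j < n \<Longrightarrow> trop_pow B t $$ (i, j) \<le> max (csr_entry t i j) (-1)"
    using pow_eventually_le_csr_entry by blast
  show ?thesis
  proof (intro exI allI impI)
    fix t i and x :: "nat \<Rightarrow> real"
    assume t: "max T (T0 + 2 * (n * g)) \<le> t" and x: "\<forall>j<n. x j \<le> 1" and i: "i < n"
    have "trop_pow B t $$ (i, j) + ereal (x j) \<le> max (SUP j\<in>{0..<n}. csr_entry t i j + ereal (x j)) 0"
      if j: "j < n" for j
    proof (cases "trop_pow B t $$ (i, j) \<le> csr_entry t i j")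
      case True
      then have "trop_pow B t $$ (i, j) + ereal (x j) \<le> csr_entry t i j + ereal (x j)"
        by (rule add_right_mono)
      also have "\<dots> \<le> (SUP j\<in>{0..<n}. csr_entry t i j + ereal (x j))"
        using j by (intro SUP_upper) auto
      finally show ?thesis by (rule max.coboundedI1)
    next
      case False
      then have "trop_pow B t $$ (i, j) \<le> -1" using T[of t i j] t i j by (auto simp: le_max_iff_disj)
      then have "trop_pow B t $$ (i, j) + ereal (x j) \<le> -1 + ereal 1"
        using x j by (intro add_mono) auto
      then show ?thesis by (simp add: max.coboundedI2 one_ereal_def zero_ereal_def)
    qed
    then have "(SUP j\<in>{0..<n}. trop_pow B t $$ (i, j) + ereal (x j))
        \<le> max (SUP j\<in>{0..<n}. csr_entry t i j + ereal (x j)) 0"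
      by (intro SUP_least) auto
    moreover have "(SUP j\<in>{0..<n}. csr_entry t i j + ereal (x j))
        \<le> (SUP j\<in>{0..<n}. trop_pow B t $$ (i, j) + ereal (x j))"
      using t i by (intro SUP_mono' SUP_subset_mono add_right_mono csr_entry_le_pow) auto
    ultimately show "max 0 (SUP j\<in>{0..<n}. trop_pow B t $$ (i, j) + ereal (x j))
      = max (SUP j\<in>{0..<n}. csr_entry t i j + ereal (x j)) 0"
      by (intro antisym) (auto simp: max.coboundedI2 max.coboundedI1)
  qed
qed

text \<open>No cut-off appears on the right, since that side is nonnegative already: some
  \<open>l\<close> is reached from \<open>i\<close> by \<open>t\<close> critical edges, and
  \<open>star l l\<close> and \<open>x l\<close> are nonnegative.\<close>

lemma pow_vec_critical_row_eq:
  fixes x :: "nat \<Rightarrow> real"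
  assumes t: "T0 + 2 * (n * g) \<le> t" and x: "\<And>j. j < n \<Longrightarrow> 0 \<le> x j" and i: "i < c"
  shows "max 0 (SUP j\<in>{0..<n}. trop_pow B t $$ (i, j) + ereal (x j))
    = (SUP j\<in>{0..<n}. (SUP l\<in>{0..<c}. (if (i, l) \<in> E ^^ t then 0 else -\<infinity>) + star l j) + ereal (x j))"
    (is "max 0 ?lhs = ?rhs")
proof (rule antisym)
  have i': "i < n" using i c_le by simp
  have ge: "star l j + ereal (x j) \<le> ?rhs" if "(i, l) \<in> E ^^ t" "j < n" for l j
    using that relpow_less[OF that(1) i]
    by (intro SUP_upper2[of j] add_right_mono SUP_upper2[of l]) auto
  have "?lhs \<le> ?rhs"
  proof (rule SUP_least)
    fix j assume j: "j \<in> {0..<n}"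
    obtain l where l: "(i, l) \<in> E ^^ t" "trop_pow B t $$ (i, j) \<le> star l j"
      using pow_critical_row_le[of t i j] t i j by auto
    from l(2) have "trop_pow B t $$ (i, j) + ereal (x j) \<le> star l j + ereal (x j)"
      by (rule add_right_mono)
    also have "\<dots> \<le> ?rhs" using ge l(1) j by simp
    finally show "trop_pow B t $$ (i, j) + ereal (x j) \<le> ?rhs" .
  qed
  moreover have "0 \<le> ?rhs"
  proof -
    obtain l where l: "l < c" "(i, l) \<in> E ^^ t"
      using pow_critical_row_le[of t i i] t i i' by auto
    then have "0 \<le> star l l + ereal (x l)"
      using star_refl[of l] x[of l] c_le by (intro add_nonneg_nonneg) auto
    also have "\<dots> \<le> ?rhs" using ge l c_le by simp
    finally show ?thesis .
  qed
  ultimately show "max 0 ?lhs \<le> ?rhs" by simp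
  have "(SUP l\<in>{0..<c}. (if (i, l) \<in> E ^^ t then 0 else -\<infinity>) + star l j) \<le> trop_pow B t $$ (i, j)"
    if j: "j < n" for j
  proof (rule SUP_least)
    fix l assume l: "l \<in> {0..<c}"
    show "(if (i, l) \<in> E ^^ t then 0 else -\<infinity>) + star l j \<le> trop_pow B t $$ (i, j)"
    proof (cases "(i, l) \<in> E ^^ t")
      case True
      \<comment> \<open>\<open>star i i\<close> stands in for the factor C, so that
        \<open>star_relpow_star_le_pow\<close> applies with \<open>k = i\<close>.\<close>
      have "0 + star l j \<le> star i i + star l j"
        using star_refl[OF i'] by (rule add_right_mono)
      also have "\<dots> \<le> trop_pow B t $$ (i, j)"
        using star_relpow_star_le_pow[OF t i' j i _ True] l by simp
      finally show ?thesis using True by simp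
    next
      case False
      moreover have "-\<infinity> + star l j = -\<infinity>"
        using star_nonpos[of l j] l j c_le by (cases "star l j") auto
      ultimately have "(if (i, l) \<in> E ^^ t then 0 else -\<infinity>) + star l j = -\<infinity>" by (simp only: if_False)
      then show ?thesis by (rule eq_refl[THEN order_trans]) simp
    qed
  qed
  then have "?rhs \<le> ?lhs"
    by (intro SUP_subset_mono add_right_mono) auto
  then show "?rhs \<le> max 0 ?lhs" by (rule max.coboundedI2)
qed

end

section \<open>Max-Lukasiewicz powers\<close>

text \<open>Two successive cut-offs merge into one: if \<open>1 + m\<close> is negative, then
  \<open>p = 0\<close> and both sides vanish because \<open>y \<le> 1\<close>.\<close>

lemma ereal_luk_times:
  assumes "ereal p = max 0 (1 + m)" "m \<le> 0" "y \<le> 1"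
  shows "ereal (p \<otimes>\<^sub>L y) = max 0 (m + ereal y)"
proof (cases m)
  case (real r)
  then have "p = max 0 (1 + r)" using assms(1) by (simp add: one_ereal_def zero_ereal_def max_def split: if_splits)
  with real assms(3) show ?thesis
    by (auto simp: luk_times_def zero_ereal_def max_def)
next
  case MInf
  then have "p = 0" using assms(1) by (simp add: zero_ereal_def max_def)
  with MInf assms(3) show ?thesis by (simp add: luk_times_def zero_ereal_def max_def)
qed (use assms in auto)

text \<open>\<open>0 < n\<close> keeps the index sets of the maxima nonempty; \<open>Max\<close> of
  the empty set is unspecified.\<close>

locale luk_mat =
  fixes n :: nat and A :: "real mat"
  assumes A [simp]: "A \<in> carrier_mat n n" and n: "0 < n"
    and unit: "\<And>i j. i < n \<Longrightarrow> j < n \<Longrightarrow> A $$ (i, j) \<in> {0..1}"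
begin

section \<open>Truncation of tropical powers\<close>

lemma index_minus_one: "i < n \<Longrightarrow> j < n \<Longrightarrow> mat_minus_one A $$ (i, j) = ereal (A $$ (i, j) - 1)"
  using carrier_matD[OF A] by (simp add: mat_minus_one_def)

sublocale nonpos_mat n "mat_minus_one A"
proof
  show "mat_minus_one A \<in> carrier_mat n n" by (simp add: mat_minus_one_def)
  show "mat_minus_one A $$ (i, j) \<le> 0" if "i < n" "j < n" for i j
    using unit[OF that] index_minus_one[OF that] by (simp add: zero_ereal_def)
qed

lemma luk_pow_carrier [simp]: "luk_pow A t \<in> carrier_mat n n"
  using carrier_matD[OF A] by (induction t) (auto simp: luk_mult_def)

text \<open>The map from \<open>z\<close> to \<open>max 0 (1 + z)\<close> is monotone, so it
  commutes with the finite maxima of the product; with \<open>ereal_luk_times\<close> it carries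
  tropical powers to max-Lukasiewicz powers.\<close>

lemma ereal_luk_pow:
  "i < n \<Longrightarrow> j < n \<Longrightarrow> ereal (luk_pow A t $$ (i, j)) = max 0 (1 + trop_pow (mat_minus_one A) t $$ (i, j))"
proof (induction t arbitrary: j)
  case 0
  then show ?case
    using carrier_matD[OF A] by (simp add: pow_0 zero_ereal_def one_ereal_def max_def del: trop_pow.simps)
next
  case (Suc t)
  let ?M = "trop_pow (mat_minus_one A) t"
  have "ereal (luk_pow A (Suc t) $$ (i, j)) = ereal (MAX l\<in>{0..<n}. luk_pow A t $$ (i, l) \<otimes>\<^sub>L A $$ (l, j))"
    using carrier_matD[OF A] carrier_matD[OF luk_pow_carrier, of t] Suc.prems by (simp add: luk_mult_def)
  also have "\<dots> = (SUP l\<in>{0..<n}. ereal (luk_pow A t $$ (i, l) \<otimes>\<^sub>L A $$ (l, j)))"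
    using n by (intro ereal_Max) auto
  also have "\<dots> = (SUP l\<in>{0..<n}. max 0 (1 + (?M $$ (i, l) + mat_minus_one A $$ (l, j))))"
  proof (intro SUP_cong refl)
    fix l assume l: "l \<in> {0..<n}"
    then have "ereal (luk_pow A t $$ (i, l) \<otimes>\<^sub>L A $$ (l, j)) = max 0 (?M $$ (i, l) + ereal (A $$ (l, j)))"
      using Suc pow_nonpos[of i l t] unit[of l j] by (intro ereal_luk_times) auto
    also have "?M $$ (i, l) + ereal (A $$ (l, j)) = 1 + (?M $$ (i, l) + mat_minus_one A $$ (l, j))"
      using l Suc.prems by (cases "?M $$ (i, l)") (auto simp: index_minus_one one_ereal_def)
    finally show "ereal (luk_pow A t $$ (i, l) \<otimes>\<^sub>L A $$ (l, j)) = max 0 (1 + (?M $$ (i, l) + mat_minus_one A $$ (l, j)))" .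
  qed
  also have "\<dots> = max 0 (1 + (SUP l\<in>{0..<n}. ?M $$ (i, l) + mat_minus_one A $$ (l, j)))"
    using n by (intro mono_SUP_finite[symmetric, where g = "\<lambda>z. max 0 (1 + z)"])
      (auto simp: mono_def add_left_mono max.coboundedI2)
  finally show ?case
    by (simp only: index_trop_pow_Suc[OF carrier Suc.prems])
qed

lemma ereal_luk_mult_vec:
  assumes x: "x \<in> carrier_vec n" "\<And>j. j < n \<Longrightarrow> x $ j \<le> 1" and i: "i < n"
  shows "ereal (luk_mult_vec (luk_pow A t) x $ i)
    = max 0 (SUP j\<in>{0..<n}. trop_pow (mat_minus_one A) t $$ (i, j) + ereal (x $ j))"
proof -
  let ?M = "trop_pow (mat_minus_one A) t"
  have "ereal (luk_mult_vec (luk_pow A t) x $ i) = ereal (MAX j\<in>{0..<n}. luk_pow A t $$ (i, j) \<otimes>\<^sub>L x $ j)"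
    using carrier_matD[OF luk_pow_carrier, of t] i by (simp add: luk_mult_vec_def)
  also have "\<dots> = (SUP j\<in>{0..<n}. ereal (luk_pow A t $$ (i, j) \<otimes>\<^sub>L x $ j))"
    using n by (intro ereal_Max) auto
  also have "\<dots> = (SUP j\<in>{0..<n}. max 0 (?M $$ (i, j) + ereal (x $ j)))"
    using i x pow_nonpos[of i _ t] by (intro SUP_cong refl ereal_luk_times) (auto simp: ereal_luk_pow)
  also have "\<dots> = max 0 (SUP j\<in>{0..<n}. ?M $$ (i, j) + ereal (x $ j))"
    using n by (intro mono_SUP_finite[symmetric, where g = "max 0"]) (auto simp: mono_def max.coboundedI2)
  finally show ?thesis .
qed

text \<open>Edges of weight \<open>1\<close> in \<open>A\<close>, written through
  \<open>mat_minus_one A\<close> so that the set agrees literally with the zero edges in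
  \<open>walk_weight_eventually_le\<close> and \<open>critical_relation\<close>.\<close>

abbreviation one_edges :: "(nat \<times> nat) set" where
  "one_edges \<equiv> {(i, j). i < n \<and> j < n \<and> mat_minus_one A $$ (i, j) = 0}"

lemma one_edges_iff: "(i, j) \<in> one_edges \<longleftrightarrow> i < n \<and> j < n \<and> A $$ (i, j) = 1"
  by (auto simp: index_minus_one zero_ereal_def)

section \<open>Cycles of mean 1\<close>

sublocale mat_graph: pair_fin_digraph "mat_digraph A"
  by unfold_locales (auto simp: mat_digraph_def)

lemma mat_digraph_simps: "pverts (mat_digraph A) = {0..<n}" "parcs (mat_digraph A) = {0..<n} \<times> {0..<n}"
  using carrier_matD[OF A] by (simp_all add: mat_digraph_def)

lemma trancl_one_edges_walk:
  "(u, v) \<in> one_edges\<^sup>+ \<Longrightarrow> \<exists>p. p \<noteq> [] \<and> mat_graph.awalk u p v \<and> set p \<subseteq> one_edges"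
proof (induction rule: trancl_induct)
  case (base v)
  then show ?case
    by (intro exI[of _ "[(u, v)]"]) (auto simp: mat_graph.awalk_Cons_iff mat_graph.awalk_Nil_iff mat_digraph_simps)
next
  case (step v w)
  then obtain p where "p \<noteq> []" "mat_graph.awalk u p v" "set p \<subseteq> one_edges" by blast
  moreover have "mat_graph.awalk v [(v, w)] w"
    using step(2) by (auto simp: mat_graph.awalk_Cons_iff mat_graph.awalk_Nil_iff mat_digraph_simps)
  ultimately show ?case
    using step(2) by (intro exI[of _ "p @ [(v, w)]"]) auto
qed

text \<open>No entry exceeds \<open>1\<close>, so an average of \<open>1\<close> forces every entry
  on the cycle to be \<open>1\<close>.\<close>

lemma cycle_mean_eq_1_iff:
  assumes "p \<in> mat_cycles A"
  shows "cycle_mean A p = 1 \<longleftrightarrow> set p \<subseteq> one_edges"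
proof -
  have p: "p \<noteq> []" "set p \<subseteq> {0..<n} \<times> {0..<n}"
    using assms by (auto simp: mat_cycles_def mat_graph.awalk_def mat_digraph_simps)
  then have le: "(\<Sum>e\<leftarrow>p. A $$ e) \<le> real (length p) \<and> ((\<Sum>e\<leftarrow>p. A $$ e) = real (length p) \<longleftrightarrow> (\<forall>e\<in>set p. A $$ e = 1))"
  proof (induction p)
    case (Cons e p)
    then have "A $$ e \<le> 1" using unit by auto
    with Cons show ?case by (cases "p = []") auto
  qed simp
  moreover have "cycle_mean A p = 1 \<longleftrightarrow> (\<Sum>e\<leftarrow>p. A $$ e) = real (length p)"
    using p(1) by (auto simp: cycle_mean_def field_simps)
  moreover have "set p \<subseteq> one_edges \<longleftrightarrow> (\<forall>e\<in>set p. A $$ e = 1)"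
    using p(2) one_edges_iff by auto
  ultimately show ?thesis by simp
qed

lemma trancl_one_edges_cycle:
  assumes "(u, u) \<in> one_edges\<^sup>+"
  obtains p where "p \<in> mat_cycles A" "cycle_mean A p = 1" "u \<in> fst ` set p"
proof -
  obtain p where p: "p \<noteq> []" "mat_graph.awalk u p u" "set p \<subseteq> one_edges"
    using trancl_one_edges_walk[OF assms] by blast
  then have "p \<in> mat_cycles A" by (auto simp: mat_cycles_def)
  moreover have "u \<in> fst ` set p" using p by (cases p) (auto simp: mat_graph.awalk_Cons_iff)
  ultimately show ?thesis using p(3) by (intro that[of p]) (simp_all add: cycle_mean_eq_1_iff)
qed

text \<open>With all cycle means below \<open>1\<close>, no node lies on a closed walk of edges of
  weight \<open>1\<close>, so every long walk has weight at most \<open>-1\<close>.\<close>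

lemma luk_mult_vec_eventually_zero:
  assumes "max_cycle_mean A < 1" and x: "x \<in> carrier_vec n" "\<And>j. j < n \<Longrightarrow> x $ j \<le> 1"
  shows "\<exists>T. \<forall>t\<ge>T. luk_mult_vec (luk_pow A t) x = 0\<^sub>v n"
proof -
  have acyclic: "(u, u) \<notin> one_edges\<^sup>+" for u
  proof
    assume "(u, u) \<in> one_edges\<^sup>+"
    then obtain p where "p \<in> mat_cycles A" "cycle_mean A p = 1" by (rule trancl_one_edges_cycle)
    then show False using assms(1) cycle_mean_le_max_cycle_mean[of p A] by simp
  qed
  obtain T where T: "\<And>t w. T \<le> t \<Longrightarrow> \<forall>m\<le>t. w m < n \<and> (w m, w m) \<notin> one_edges\<^sup>+
      \<Longrightarrow> walk_weight (mat_minus_one A) w t \<le> -1"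
    using walk_weight_eventually_le by blast
  show ?thesis
  proof (intro exI allI impI)
    fix t assume t: "T \<le> t"
    have le: "trop_pow (mat_minus_one A) t $$ (i, j) \<le> -1" if ij: "i < n" "j < n" for i j
    proof (cases "trop_pow (mat_minus_one A) t $$ (i, j) = -\<infinity>")
      case False
      then obtain w where "\<forall>m\<le>t. w m < n" "walk_weight (mat_minus_one A) w t = trop_pow (mat_minus_one A) t $$ (i, j)"
        using pow_walk ij by blast
      with T[OF t, of w] acyclic show ?thesis by simp
    qed simp
    have "luk_mult_vec (luk_pow A t) x $ i = 0" if i: "i < n" for i
    proof -
      have "trop_pow (mat_minus_one A) t $$ (i, j) + ereal (x $ j) \<le> -1 + ereal 1" if "j < n" for j
        using le[OF i that] x(2)[OF that] by (intro add_mono) auto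
      then have "(SUP j\<in>{0..<n}. trop_pow (mat_minus_one A) t $$ (i, j) + ereal (x $ j)) \<le> 0"
        by (intro SUP_least) (simp add: one_ereal_def zero_ereal_def)
      then show ?thesis using ereal_luk_mult_vec[OF x i, of t] by (simp add: max_absorb1)
    qed
    then show "luk_mult_vec (luk_pow A t) x = 0\<^sub>v n"
      using carrier_matD[OF luk_pow_carrier, of t] by (intro eq_vecI) (auto simp: luk_mult_vec_def)
  qed
qed

end

text \<open>A closed walk may start at the tail of any of its edges; this turns each node of a
  critical cycle into a base point.\<close>

lemma pcas_rotate:
  assumes "pcas u p u" "e \<in> set p"
  obtains q where "set q = set p" "q \<noteq> []" "pcas (fst e) q (fst e)" "length q = length p"
proof -
  obtain r s where p: "p = r @ e # s" using assms(2) by (meson split_list)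
  have app: "pcas a (q @ q') b \<longleftrightarrow> (\<exists>v. pcas a q v \<and> pcas v q' b)" for a b q q'
    by (induction q arbitrary: a) auto
  have "pcas (fst e) ((e # s) @ r) (fst e)"
    using assms(1) unfolding p app by auto
  then show ?thesis using that[of "(e # s) @ r"] p by auto
qed

text \<open>The nodes of \<open>critical_graph\<close> are collected from tails only. On a closed
  walk each head is the tail of the cyclically next edge, which makes the critical graph
  well-formed.\<close>

lemma pcas_snd_in_fst:
  assumes "pcas u p u" "e \<in> set p"
  shows "snd e \<in> fst ` set p"
proof -
  obtain r s where p: "p = r @ e # s" using assms(2) by (meson split_list)
  obtain v where "pcas u r v" "pcas v (e # s) u"
    using assms(1) unfolding p by (metis pre_digraph.cas_append_iff cas_with_proj_eq)
  then show ?thesis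
    unfolding p by (cases s; cases r) auto
qed

section \<open>The critical graph at maximum cycle mean 1\<close>

locale luk_mat_critical = luk_mat +
  fixes c :: nat
  assumes mcm: "max_cycle_mean A = 1"
    and c: "pverts (critical_graph A) = {0..<c}"
begin

lemma critical_cycles_eq: "critical_cycles A = {p \<in> mat_cycles A. set p \<subseteq> one_edges}"
  using cycle_mean_eq_1_iff by (auto simp: critical_cycles_def mcm)

lemma critical_cycle_pcas:
  assumes "p \<in> critical_cycles A"
  obtains u where "p \<noteq> []" "pcas u p u" "set p \<subseteq> one_edges"
  using assms by (auto simp: critical_cycles_eq mat_cycles_def mat_graph.awalk_def)

lemma critical_arcs_one: "parcs (critical_graph A) \<subseteq> one_edges"
  by (auto simp: critical_graph_def critical_cycles_eq)

lemma c_le_n: "c \<le> n"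
proof -
  have "pverts (critical_graph A) \<subseteq> {0..<n}"
    by (auto simp: critical_graph_def critical_cycles_eq)
  then show ?thesis unfolding c by auto
qed

sublocale crit: pair_fin_digraph "critical_graph A"
proof
  show "finite (pverts (critical_graph A))" by (simp add: c)
  show "finite (parcs (critical_graph A))"
    by (rule finite_subset[OF critical_arcs_one], rule finite_subset[of _ "{..<n} \<times> {..<n}"]) auto
  show "fst e \<in> pverts (critical_graph A)" if "e \<in> parcs (critical_graph A)" for e
    using that by (auto simp: critical_graph_def)
  show "snd e \<in> pverts (critical_graph A)" if e: "e \<in> parcs (critical_graph A)" for e
  proof -
    obtain p where p: "p \<in> critical_cycles A" "e \<in> set p" using e by (auto simp: critical_graph_def)
    obtain u where "pcas u p u" using critical_cycle_pcas[OF p(1)] by blast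
    then have "snd e \<in> fst ` set p" using p(2) by (rule pcas_snd_in_fst)
    with p(1) show ?thesis by (auto simp: critical_graph_def image_iff)
  qed
qed

lemma critical_closed_awalk:
  assumes "k \<in> pverts (critical_graph A)"
  shows "\<exists>p. p \<noteq> [] \<and> crit.awalk k p k"
proof -
  obtain p e where p: "p \<in> critical_cycles A" and e: "e \<in> set p" "k = fst e"
    using assms by (auto simp: critical_graph_def)
  obtain u where "pcas u p u" using critical_cycle_pcas[OF p] by blast
  then obtain q where "set q = set p" "q \<noteq> []" "pcas k q k" using pcas_rotate e by metis
  moreover have "set p \<subseteq> parcs (critical_graph A)" using p by (auto simp: critical_graph_def)
  ultimately show ?thesis
    using assms by (intro exI[of _ q]) (simp add: crit.awalk_def)
qed

lemma cyclicity_critical_pos: "0 < cyclicity (critical_graph A)"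
  using crit.cyclicity_pos critical_closed_awalk by simp

lemma critical_relation_exists:
  "\<exists>T. critical_relation n (mat_minus_one A) (parcs (critical_graph A)) c (cyclicity (critical_graph A)) T"
proof -
  obtain T where T: "\<forall>s\<ge>T. \<forall>k\<in>pverts (critical_graph A). \<forall>l\<in>pverts (critical_graph A). \<forall>t.
      (k, l) \<in> parcs (critical_graph A) ^^ t \<longrightarrow>
      s mod cyclicity (critical_graph A) = t mod cyclicity (critical_graph A) \<longrightarrow>
      (k, l) \<in> parcs (critical_graph A) ^^ s"
    using crit.relpow_eventually_periodic[OF cyclicity_critical_pos] by blast
  show ?thesis
  proof (intro exI, unfold_locales)
    show "c \<le> n" by (rule c_le_n)
    show "i < c \<and> j < c \<and> mat_minus_one A $$ (i, j) = 0" if "(i, j) \<in> parcs (critical_graph A)" for i j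
      using crit.wellformed'[OF that] critical_arcs_one that c by auto
    show "(k, k) \<in> (parcs (critical_graph A))\<^sup>+" if "k < c" for k
    proof -
      have k: "k \<in> pverts (critical_graph A)" using that c by simp
      then obtain p where "p \<noteq> []" "crit.awalk k p k" using critical_closed_awalk by blast
      then show ?thesis
        using crit.relpow_iff_awalk[OF k, of k "length p"] by (auto simp: trancl_power)
    qed
    \<comment> \<open>A closed walk of edges of weight \<open>1\<close> has maximum mean, hence is a
      critical cycle, and its nodes are below \<open>c\<close>.\<close>
    show "(k, k) \<notin> one_edges\<^sup>+" if "c \<le> k" "k < n" for k
    proof
      assume "(k, k) \<in> one_edges\<^sup>+"
      then obtain p where "p \<in> critical_cycles A" "k \<in> fst ` set p"
        using trancl_one_edges_cycle mcm by (metis (mono_tags, lifting) critical_cycles_def mem_Collect_eq)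
      then have "k \<in> pverts (critical_graph A)" by (auto simp: critical_graph_def)
      with c that show False by simp
    qed
    show "0 < cyclicity (critical_graph A)" by (rule cyclicity_critical_pos)
    show "(k, l) \<in> parcs (critical_graph A) ^^ s"
      if "T \<le> s" "k < c" "l < c" "(k, l) \<in> parcs (critical_graph A) ^^ t"
        "s mod cyclicity (critical_graph A) = t mod cyclicity (critical_graph A)" for s t k l
      using T that c by simp
  qed
qed

lemma csr_C_R_eq:
  "csr_C A c = mat n c (\<lambda>ij. kleene_star (trop_pow (mat_minus_one A) (cyclicity (critical_graph A))) $$ ij)"
  "csr_R A c = mat c n (\<lambda>ij. kleene_star (trop_pow (mat_minus_one A) (cyclicity (critical_graph A))) $$ ij)"
  using carrier_matD[OF A] by (simp_all add: csr_C_def csr_R_def csr_star_def)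

lemma csr_S_carrier: "csr_S A c \<in> carrier_mat c c"
  by (simp add: csr_S_def)

text \<open>Every critical edge has entry \<open>1\<close> in \<open>A\<close>, so the finite
  entries of S are \<open>0\<close> and its powers record only the existence of critical
  walks.\<close>

lemma index_trop_pow_csr_S:
  assumes "i < c" "j < c"
  shows "trop_pow (csr_S A c) t $$ (i, j) = (if (i, j) \<in> parcs (critical_graph A) ^^ t then 0 else -\<infinity>)"
proof (rule index_trop_pow_relpow[OF csr_S_carrier _ _ assms])
  show "parcs (critical_graph A) \<subseteq> {..<c} \<times> {..<c}"
    using crit.wellformed' c by auto
  show "csr_S A c $$ (i, j) = (if (i, j) \<in> parcs (critical_graph A) then 0 else -\<infinity>)"
    if "i < c" "j < c" for i j
    using that critical_arcs_one one_edges_iff by (auto simp: csr_S_def zero_ereal_def)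
qed

lemma luk_mult_vec_eventually_csr:
  assumes x: "x \<in> carrier_vec n" "\<And>j. j < n \<Longrightarrow> x $ j \<in> {0..1}"
  shows "\<exists>T. \<forall>t\<ge>T.
      map_vec ereal (luk_mult_vec (luk_pow A t) x)
        = csr_C A c \<otimes>\<^sub>T trop_pow (csr_S A c) t \<otimes>\<^sub>T csr_R A c \<otimes>\<^sub>T\<^sub>v map_vec ereal x \<oplus>\<^sub>T\<^sub>v 0\<^sub>v n \<and>
      (\<forall>i<c. ereal (luk_mult_vec (luk_pow A t) x $ i)
        = (trop_pow (csr_S A c) t \<otimes>\<^sub>T csr_R A c \<otimes>\<^sub>T\<^sub>v (map_vec ereal x \<oplus>\<^sub>T\<^sub>v 0\<^sub>v n)) $ i)"
proof -
  let ?E = "parcs (critical_graph A)" and ?g = "cyclicity (critical_graph A)" and ?M = "mat_minus_one A"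
  obtain T0 where "critical_relation n ?M ?E c ?g T0"
    using critical_relation_exists by blast
  then interpret critical_relation n ?M ?E c ?g T0 .
  obtain T1 where T1: "\<And>t x i. T1 \<le> t \<Longrightarrow> \<forall>j<n. x j \<le> (1 :: real) \<Longrightarrow> i < n \<Longrightarrow>
      max 0 (SUP j\<in>{0..<n}. trop_pow ?M t $$ (i, j) + ereal (x j))
        = max (SUP j\<in>{0..<n}. csr_entry t i j + ereal (x j)) 0"
    using pow_vec_eventually_eq_csr by blast
  have S: "dim_row (trop_pow (csr_S A c) t) = c" "dim_col (trop_pow (csr_S A c) t) = c" for t
    using trop_pow_carrier[OF csr_S_carrier] by (metis carrier_matD)+
  have x1: "\<And>j. j < n \<Longrightarrow> x $ j \<le> 1" using x(2) by simp
  have dims: "dim_vec (luk_mult_vec (luk_pow A t) x) = n" for t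
    using carrier_matD[OF luk_pow_carrier, of t] by (simp add: luk_mult_vec_def)
  show ?thesis
  proof (intro exI allI impI conjI)
    fix t assume t: "max T1 (T0 + 2 * (n * ?g)) \<le> t"
    show "map_vec ereal (luk_mult_vec (luk_pow A t) x)
        = csr_C A c \<otimes>\<^sub>T trop_pow (csr_S A c) t \<otimes>\<^sub>T csr_R A c \<otimes>\<^sub>T\<^sub>v map_vec ereal x \<oplus>\<^sub>T\<^sub>v 0\<^sub>v n"
      (is "_ = ?rhs")
    proof (rule eq_vecI)
      show "dim_vec (map_vec ereal (luk_mult_vec (luk_pow A t) x)) = dim_vec ?rhs"
        by (simp add: dims trop_add_vec_def trop_mult_vec_def trop_mult_def csr_C_R_eq)
      fix i assume "i < dim_vec ?rhs"
      then have i: "i < n"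
        by (simp add: trop_add_vec_def trop_mult_vec_def trop_mult_def csr_C_R_eq)
      have "?rhs $ i = max (SUP j\<in>{0..<n}. csr_entry t i j + ereal (x $ j)) 0"
        using i x(1) by (simp add: trop_add_vec_def trop_mult_vec_def trop_mult_def csr_C_R_eq S
            index_trop_pow_csr_S)
      also have "\<dots> = max 0 (SUP j\<in>{0..<n}. trop_pow ?M t $$ (i, j) + ereal (x $ j))"
        using T1[of t "\<lambda>j. x $ j" i] t i x1 by simp
      also have "\<dots> = ereal (luk_mult_vec (luk_pow A t) x $ i)"
        using ereal_luk_mult_vec[OF x(1) x1 i] by simp
      finally show "map_vec ereal (luk_mult_vec (luk_pow A t) x) $ i = ?rhs $ i"
        using i dims by simp
    qed
    fix i assume i: "i < c"
    then have "i < n" using c_le_n by simp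
    have "ereal (luk_mult_vec (luk_pow A t) x $ i)
        = max 0 (SUP j\<in>{0..<n}. trop_pow ?M t $$ (i, j) + ereal (x $ j))"
      using ereal_luk_mult_vec[OF x(1) x1 \<open>i < n\<close>] .
    also have "\<dots> = (SUP j\<in>{0..<n}. (SUP l\<in>{0..<c}. (if (i, l) \<in> ?E ^^ t then 0 else -\<infinity>) + star l j) + ereal (x $ j))"
      using t x(2) i by (intro pow_vec_critical_row_eq) auto
    \<comment> \<open>As \<open>x\<close> is nonnegative, adding the zero vector tropically leaves
      it unchanged.\<close>
    also have "\<dots> = (trop_pow (csr_S A c) t \<otimes>\<^sub>T csr_R A c \<otimes>\<^sub>T\<^sub>v (map_vec ereal x \<oplus>\<^sub>T\<^sub>v 0\<^sub>v n)) $ i"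
      using i x by (simp add: trop_add_vec_def trop_mult_vec_def trop_mult_def csr_C_R_eq S
          index_trop_pow_csr_S max_absorb1)
    finally show "ereal (luk_mult_vec (luk_pow A t) x $ i)
        = (trop_pow (csr_S A c) t \<otimes>\<^sub>T csr_R A c \<otimes>\<^sub>T\<^sub>v (map_vec ereal x \<oplus>\<^sub>T\<^sub>v 0\<^sub>v n)) $ i" .
  qed
qed

end

theorem theorem21:
  fixes A :: "real mat" and x :: "real vec" and n c :: nat
  assumes "n \<ge> 1"
    and "A \<in> carrier_mat n n" and "\<And>i j. i < n \<Longrightarrow> j < n \<Longrightarrow> A $$ (i, j) \<in> {0..1}"
    and "x \<in> carrier_vec n" and "\<And>i. i < n \<Longrightarrow> x $ i \<in> {0..1}"
    and "max_cycle_mean A = 1 \<Longrightarrow> pverts (critical_graph A) = {0..<c}"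
  shows "\<exists>T. \<forall>t\<ge>T.
    (max_cycle_mean A < 1 \<longrightarrow> luk_mult_vec (luk_pow A t) x = 0\<^sub>v n) \<and>
    (max_cycle_mean A = 1 \<longrightarrow>
      map_vec ereal (luk_mult_vec (luk_pow A t) x)
        = csr_C A c \<otimes>\<^sub>T trop_pow (csr_S A c) t \<otimes>\<^sub>T csr_R A c \<otimes>\<^sub>T\<^sub>v map_vec ereal x \<oplus>\<^sub>T\<^sub>v 0\<^sub>v n \<and>
      (\<forall>i<c. ereal (luk_mult_vec (luk_pow A t) x $ i)
        = (trop_pow (csr_S A c) t \<otimes>\<^sub>T csr_R A c \<otimes>\<^sub>T\<^sub>v (map_vec ereal x \<oplus>\<^sub>T\<^sub>v 0\<^sub>v n)) $ i))"
proof -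
  interpret luk_mat n A using assms(1-3) by unfold_locales auto
  consider "max_cycle_mean A < 1" | "max_cycle_mean A = 1" | "1 < max_cycle_mean A" by linarith
  then show ?thesis
  proof cases
    case 1
    then show ?thesis using luk_mult_vec_eventually_zero[OF 1 assms(4)] assms(5) by auto
  next
    case 2
    interpret luk_mat_critical n A c using assms(6) 2 by unfold_locales auto
    show ?thesis using luk_mult_vec_eventually_csr[OF assms(4,5)] 2 by simp
  \<comment> \<open>In the remaining case \<open>1 < max_cycle_mean A\<close> both implications are
    vacuous.\<close>
  qed auto
qed

end
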